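(* Let $g>0$ and $0\le c_l\le c_u$ be constants. There exists $\varepsilon_0\in(0,1)$ (that is, the following holds for all sufficiently small $\varepsilon>0$) such that for every $\varepsilon\in(0,\varepsilon_0]$ and all constants $k_1,k_2,k_3,k_u,k_v\in\mathbb{R}$ satisfying $$k_3>0,\qquad k_1>1+\frac{k_3}{2\varepsilon^2},\qquad k_2>1+\frac{k_3}{2\varepsilon^2},$$ $$k_u>\frac{k_1^2c_u^2}{2g^2}+\frac{g^2}{2},\qquad k_v>\frac{k_2^2c_u^2}{2g^2}+\frac{g^2}{2},$$ the following holds. Let $p,q,r,c:[0,\infty)\to\mathbb{R}$ be continuous functions with $c(t)>0$ and $c_l\le c(t)\le c_u$ for all $t\ge0$, and let $(u,v,\eta_1,\eta_2,\eta_3):[0,\infty)\to\mathbb{R}^5$ be a trajectory of the design system $$\dot u=g\eta_1-cu,\qquad \dot v=g\eta_2-cv,$$ $$\dot\eta_1=r\eta_2-q\eta_3,\qquad \dot\eta_2=p\eta_3-r\eta_1,\qquad \dot\eta_3=q\eta_1-p\eta_2,\qquad \eta_1^2+\eta_2^2+\eta_3^2=1,$$ such that $\eta_3(t)\ge\varepsilon$ for all $t\ge0$. Put $a_x:=-cu$ and $a_y:=-cv$, and consider the observer $$\dot{\hat u}=g\hat\eta_1-c\hat u-(k_u+k_1)\Bigl(\hat u+\frac{a_x}{c}\Bigr),$$ $$\dot{\hat v}=g\hat\eta_2-c\hat v-(k_v+k_2)\Bigl(\hat v+\frac{a_y}{c}\Bigr),$$ $$\dot{\hat\eta}_1=r\hat\eta_2-q\hat\eta_3-\frac{k_1k_u}{g}\Bigl(\hat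 u+\frac{a_x}{c}\Bigr)-\frac{rk_2}{g}\Bigl(\hat v+\frac{a_y}{c}\Bigr),$$ $$\dot{\hat\eta}_2=p\hat\eta_3-r\hat\eta_1+\frac{rk_1}{g}\Bigl(\hat u+\frac{a_x}{c}\Bigr)-\frac{k_2k_v}{g}\Bigl(\hat v+\frac{a_y}{c}\Bigr),$$ $$\dot{\hat\eta}_3=q\hat\eta_1-p\hat\eta_2-\frac{qk_1}{g}\Bigl(\hat u+\frac{a_x}{c}\Bigr)+\frac{pk_2}{g}\Bigl(\hat v+\frac{a_y}{c}\Bigr)-k_3E\Bigl(\hat\eta_1-\frac{k_1}{g}\Bigl(\hat u+\frac{a_x}{c}\Bigr),\ \hat\eta_2-\frac{k_2}{g}\Bigl(\hat v+\frac{a_y}{c}\Bigr),\ \hat\eta_3\Bigr),$$ where $E$ is the function (depending on $\varepsilon$) defined in the context. Then, whatever the initial condition $\bigl(\hat u(0),\hat v(0),\hat\eta_1(0),\hat\eta_2(0),\hat\eta_3(0)\bigr)\in\mathbb{R}^5$, the corresponding solution of the observer satisfies $$\lim_{t\to+\infty}\bigl(\hat u(t),\hat v(t),\hat\eta_1(t),\hat\eta_2(t),\hat\eta_3(t)\bigr)-\bigl(u(t),v(t),\eta_1(t),\eta_2(t),\eta_3(t)\bigr)=0.$$ Moreover the convergence is uniform in the following sense: writing $e(t):=(\hat u-u,\hat v-v,\hat\eta_1-\eta_1,\hat\eta_2-\eta_2,\hat\eta_3-\eta_3)(t)$, for all $R>0$ and $\delta>0$ there exists $T>0$ such that for every $t_0\ge0$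 and every solution of the observer started at time $t_0$ with $|e(t_0)|\le R$, one has $|e(t)|\le\delta$ for all $t\ge t_0+T$.
   Context: The design system is a simplified model of a quadrotor: $u,v$ are in-plane velocity components in body axes, $(\eta_1,\eta_2,\eta_3)$ is the third column of the rotation matrix from the Earth frame to the body frame, $p,q,r$ are the (measured) angular velocities, $g$ is the gravity constant, $c$ is a known time-varying drag coefficient, and $a_x=-cu$, $a_y=-cv$ are the (perfect) accelerometer measurements. All of $u,v,p,q,r,c$ are available to the observer; $\eta_1,\eta_2,\eta_3$ are not measured. For $\varepsilon\in(0,1)$ define the saturation function $$\mathrm{sat}(x):=\min\Bigl(1,\frac{1-\varepsilon^2}{|x|}\Bigr)x\quad(x\in\mathbb{R}),\qquad \mathrm{sat}(0)=0,$$ and $$E(x_1,x_2,x_3):=\frac{x_3-\sqrt{1-\mathrm{sat}(x_1^2+x_2^2)}}{x_1^2+x_2^2+1-\varepsilon^2},\qquad (x_1,x_2,x_3)\in\mathbb{R}^3.$$ $|\cdot|$ denotes the Euclidean norm. The observer's estimate $(\hat\eta_1,\hat\eta_2,\hat\eta_3)$ is not constrained to the unit sphere. *)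

theory Defs
  imports "HOL-Analysis.Analysis"
begin

text \<open>
  States are tuples (u, v, eta1, eta2, eta3); the product norm on nested pairs of reals is the
  Euclidean norm.
\<close>

type_synonym state = "real \<times> real \<times> real \<times> real \<times> real"

text \<open>The one-sided derivative is used at the initial time.\<close>

definition solves_ode_from ::
    "(real \<Rightarrow> 'a::real_normed_vector \<Rightarrow> 'a) \<Rightarrow> real \<Rightarrow> (real \<Rightarrow> 'a) \<Rightarrow> bool" where
  "solves_ode_from f t0 x \<longleftrightarrow>
     (\<forall>t\<ge>t0. (x has_vector_derivative f t (x t)) (at t within {t0..}))"

text \<open>The value at 0 is 0, as required, since division by zero yields zero.\<close>

definition sat :: "real \<Rightarrow> real \<Rightarrow> real" where
  "sat \<epsilon> x = min 1 ((1 - \<epsilon>\<^sup>2) / \<bar>x\<bar>) * x"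

definition E :: "real \<Rightarrow> real \<Rightarrow> real \<Rightarrow> real \<Rightarrow> real" where
  "E \<epsilon> x1 x2 x3 =
     (x3 - sqrt (1 - sat \<epsilon> (x1\<^sup>2 + x2\<^sup>2))) / (x1\<^sup>2 + x2\<^sup>2 + 1 - \<epsilon>\<^sup>2)"

definition design_field ::
    "real \<Rightarrow> (real \<Rightarrow> real) \<Rightarrow> (real \<Rightarrow> real) \<Rightarrow> (real \<Rightarrow> real) \<Rightarrow> (real \<Rightarrow> real)
     \<Rightarrow> real \<Rightarrow> state \<Rightarrow> state" where
  "design_field g p q r c t = (\<lambda>(u, v, \<eta>1, \<eta>2, \<eta>3).
     (g * \<eta>1 - c t * u,
      g * \<eta>2 - c t * v,
      r t * \<eta>2 - q t * \<eta>3,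
      p t * \<eta>3 - r t * \<eta>1,
      q t * \<eta>1 - p t * \<eta>2))"

definition design_trajectory ::
    "real \<Rightarrow> (real \<Rightarrow> real) \<Rightarrow> (real \<Rightarrow> real) \<Rightarrow> (real \<Rightarrow> real) \<Rightarrow> (real \<Rightarrow> real)
     \<Rightarrow> (real \<Rightarrow> real) \<Rightarrow> (real \<Rightarrow> real) \<Rightarrow> (real \<Rightarrow> real) \<Rightarrow> (real \<Rightarrow> real) \<Rightarrow> (real \<Rightarrow> real)
     \<Rightarrow> bool" where
  "design_trajectory g p q r c u v \<eta>1 \<eta>2 \<eta>3 \<longleftrightarrow>
     solves_ode_from (design_field g p q r c) 0 (\<lambda>t. (u t, v t, \<eta>1 t, \<eta>2 t, \<eta>3 t)) \<and>
     (\<forall>t\<ge>0. (\<eta>1 t)\<^sup>2 + (\<eta>2 t)\<^sup>2 + (\<eta>3 t)\<^sup>2 = 1)"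

text \<open>
  The observer sees the plant only through the angular velocities p, q, r, the drag
  coefficient c and the accelerometer signals ax, ay.
\<close>

definition observer_field ::
    "real \<Rightarrow> real \<Rightarrow> real \<Rightarrow> real \<Rightarrow> real \<Rightarrow> real \<Rightarrow> real
     \<Rightarrow> (real \<Rightarrow> real) \<Rightarrow> (real \<Rightarrow> real) \<Rightarrow> (real \<Rightarrow> real) \<Rightarrow> (real \<Rightarrow> real)
     \<Rightarrow> (real \<Rightarrow> real) \<Rightarrow> (real \<Rightarrow> real) \<Rightarrow> real \<Rightarrow> state \<Rightarrow> state" where
  "observer_field \<epsilon> g k1 k2 k3 ku kv p q r c ax ay t = (\<lambda>(u, v, \<eta>1, \<eta>2, \<eta>3).
     let yu = u + ax t / c t;
         yv = v + ay t / c t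
     in
     (g * \<eta>1 - c t * u - (ku + k1) * yu,
      g * \<eta>2 - c t * v - (kv + k2) * yv,
      r t * \<eta>2 - q t * \<eta>3 - k1 * ku / g * yu - r t * k2 / g * yv,
      p t * \<eta>3 - r t * \<eta>1 + r t * k1 / g * yu - k2 * kv / g * yv,
      q t * \<eta>1 - p t * \<eta>2 - q t * k1 / g * yu + p t * k2 / g * yv
        - k3 * E \<epsilon> (\<eta>1 - k1 / g * yu) (\<eta>2 - k2 / g * yv) \<eta>3))"

end

theory Submission imports Defs begin

text \<open>
  The proof rests on the coordinates \<open>a = u* - u\<close>, \<open>b = v* - v\<close>,
  \<open>z1 = (\<eta>1* - \<eta>1) - (k1 / g) a\<close>, \<open>z2 = (\<eta>2* - \<eta>2) - (k2 / g) b\<close>, \<open>z3 = \<eta>3* - \<eta>3\<close> of the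
  estimation error, where a star marks an estimate. The cross terms in the observer gains are
  chosen so that, in these coordinates, the angular velocities enter only through a
  skew-symmetric matrix acting on \<open>(z1, z2, z3)\<close>. They therefore vanish from the derivative of
  \<open>|z|\<^sup>2 / 2\<close>, and the estimates are uniform in them. Of the remaining terms, the couplings between
  \<open>a\<close> and \<open>z1\<close> and between \<open>b\<close> and \<open>z2\<close> are split by Young's inequality. The lower bounds on
  \<open>ku\<close> and \<open>kv\<close>, together with the summand 1 in those on \<open>k1\<close> and \<open>k2\<close>, pay for this
  (\<open>error_field_dissipation\<close>).

  The one nonlinear term is \<open>- k3 z3 E\<close>. Since the true direction lies on the part of the sphere
  of height at least \<open>\<epsilon>\<close>, its height \<open>\<eta>3\<close> is the function of \<open>(\<eta>1, \<eta>2)\<close> that \<open>E\<close> compares the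
  estimated height with. Hence the numerator of \<open>E\<close> is \<open>z3\<close> up to an error that is Lipschitz in
  \<open>(z1, z2)\<close>, thanks to the saturation. By Young's inequality, \<open>- z3 E\<close> is at most
  \<open>(z1\<^sup>2 + z2\<^sup>2) / (2 \<epsilon>\<^sup>2)\<close> minus a positive multiple of \<open>z3\<^sup>2\<close> (\<open>E_dissipation\<close>). The rest of the
  lower bounds on \<open>k1\<close> and \<open>k2\<close> pays for the first part.

  That multiple is half the reciprocal of the denominator of \<open>E\<close> and degenerates as the error
  grows, so it does not yield a global exponential rate. But \<open>|z|\<close> never increases, so a solution that starts in a ball stays in it,
  and on a ball the denominator is bounded. The decay is thus exponential with a rate that depends
  on the ball alone (\<open>error_exponential_decay\<close>). This gives the uniform statement, and the limit
  is a special case.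

  For the existence of solutions on a whole half-line, the obstacle is that \<open>E\<close> is not globally
  Lipschitz: its third argument is multiplied by a function of the other two. With the third
  argument clamped to a bounded interval it becomes Lipschitz, and the contraction principle in a
  weighted supremum norm gives a global solution. The clamped error system still does not
  increase \<open>|z|\<close>, and so for an interval chosen from the initial error the clamp is never
  active (\<open>error_solution\<close>).
\<close>

section \<open>Global solutions of Lipschitz fields\<close>

lemma at_within_atLeast_eq_Icc:
  fixes t0 t T :: real
  assumes "t0 \<le> t" "t < T"
  shows "at t within {t0..} = at t within {t0..T}"
  by (rule at_within_nhd[where S="{..<T}"]) (use assms in auto)

lemma integral_solves_from:
  fixes h :: "real \<Rightarrow> 'a::banach"
  assumes "continuous_on {t0..} h" and "t0 \<le> t"
  shows "((\<lambda>t. integral {t0..t} h) has_vector_derivative h t) (at t within {t0..})"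
proof -
  have "continuous_on {t0..t+1} h"
    by (rule continuous_on_subset[OF assms(1)]) auto
  from integral_has_vector_derivative[OF this, of t] assms(2)
  show ?thesis by (simp add: at_within_atLeast_eq_Icc[of t0 t "t+1"])
qed

text \<open>
  The fixed point is sought among functions \<open>\<xi> + W \<phi>\<close> with \<open>\<phi>\<close> bounded and
  \<open>W t = exp (2 \<integral> K)\<close>, where \<open>K\<close> dominates both the Lipschitz modulus and the field at \<open>\<xi>\<close>.
  As \<open>2 K W\<close> is the derivative of \<open>W\<close>, integration of \<open>K W\<close> costs a factor of one half
  relative to \<open>W\<close>. So the Picard operator halves distances on the entire half-line, and
  no gluing of local solutions occurs. Continuity of the field is assumed along continuous curves,
  the only form in which it is used.
\<close>

lemma global_solution_of_Lipschitz_field: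
  fixes f :: "real \<Rightarrow> 'a::banach \<Rightarrow> 'a" and \<Lambda> :: "real \<Rightarrow> real"
  assumes cont: "\<And>\<phi>. continuous_on {t0..} \<phi> \<Longrightarrow> continuous_on {t0..} (\<lambda>s. f s (\<phi> s))"
    and contL: "continuous_on {t0..} \<Lambda>"
    and lip: "\<And>t x y. t0 \<le> t \<Longrightarrow> norm (f t x - f t y) \<le> \<Lambda> t * norm (x - y)"
  shows "\<exists>y. solves_ode_from f t0 y \<and> y t0 = \<xi>"
proof -
  define K where "K t = \<bar>\<Lambda> t\<bar> + norm (f t \<xi>)" for t
  define W where "W t = exp (2 * integral {t0..t} K)" for t
  have contK: "continuous_on {t0..} K"
    unfolding K_def by (intro continuous_intros contL cont)
  have K0: "K t \<ge> 0" for t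
    by (simp add: K_def)
  have Wpos: "W t > 0" for t
    by (simp add: W_def)
  have W1: "W t \<ge> 1" for t
    unfolding W_def using Henstock_Kurzweil_Integration.integral_nonneg[of K "{t0..t}"] K0
    by (cases "K integrable_on {t0..t}") (auto simp: not_integrable_integral)
  have dW: "(W has_vector_derivative 2 * (K t * W t)) (at t within {t0..})" if "t0 \<le> t" for t
  proof -
    have "((\<lambda>t. integral {t0..t} K) has_real_derivative K t) (at t within {t0..})"
      using integral_solves_from[OF contK that]
      by (simp add: has_real_derivative_iff_has_vector_derivative)
    then show ?thesis
      unfolding W_def has_real_derivative_iff_has_vector_derivative[symmetric]
      by (auto intro!: derivative_eq_intros)
  qed
  have contW: "continuous_on {t0..} W"
    by (rule continuous_on_vector_derivative) (use dW in simp)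
  have KW: "((\<lambda>s. K s * W s) has_integral (W t - 1) / 2) {t0..t}" if "t0 \<le> t" for t
  proof -
    have "((\<lambda>s. 2 * (K s * W s)) has_integral (W t - W t0)) {t0..t}"
      by (rule fundamental_theorem_of_calculus[OF that])
        (auto intro: has_vector_derivative_within_subset[OF dW])
    from has_integral_mult_right[OF this, of "1/2"] show ?thesis
      by (simp add: W_def)
  qed
  \<comment> \<open>This is where the factor one half comes from: the integral of \<open>K W\<close> is \<open>(W - 1) / 2\<close>.\<close>
  have int_bound: "norm (integral {t0..t} h) \<le> b * W t / 2"
    if "t0 \<le> t" "continuous_on {t0..} h" "\<And>s. t0 \<le> s \<Longrightarrow> norm (h s) \<le> b * (K s * W s)" "0 \<le> b"
    for t b :: real and h :: "real \<Rightarrow> 'a"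
  proof -
    have hint: "h integrable_on {t0..t}"
      by (intro integrable_continuous_real continuous_on_subset[OF that(2)]) auto
    have "norm (integral {t0..t} h) \<le> integral {t0..t} (\<lambda>s. b * (K s * W s))"
      using that(3) has_integral_integrable[OF has_integral_mult_right[OF KW[OF that(1)], of b]]
      by (intro integral_norm_bound_integral hint) auto
    also have "\<dots> = b * ((W t - 1) / 2)"
      by (rule integral_unique[OF has_integral_mult_right[OF KW[OF that(1)]]])
    also have "\<dots> \<le> b * W t / 2"
      using that(4) by (simp add: field_simps)
    finally show ?thesis .
  qed
  define y_of where "y_of \<phi> s = \<xi> + W s *\<^sub>R apply_bcontfun \<phi> s" for \<phi> :: "real \<Rightarrow>\<^sub>C 'a" and s
  define J where "J \<phi> t = integral {t0..t} (\<lambda>s. f s (y_of \<phi> s))" for \<phi> t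
  \<comment> \<open>The maximum extends the Picard image to the whole line as a constant to the left of \<open>t0\<close>.\<close>
  define P where "P \<phi> t = (1 / W (max t0 t)) *\<^sub>R J \<phi> (max t0 t)" for \<phi> t
  have conty: "continuous_on {t0..} (y_of \<phi>)" for \<phi>
    unfolding y_of_def by (intro continuous_intros contW continuous_on_apply_bcontfun)
  have contf: "continuous_on {t0..} (\<lambda>s. f s (y_of \<phi> s))" for \<phi>
    by (intro cont conty)
  have dJ: "(J \<phi> has_vector_derivative f t (y_of \<phi> t)) (at t within {t0..})" if "t0 \<le> t" for \<phi> t
    unfolding J_def by (rule integral_solves_from[OF contf that])
  have contJ: "continuous_on {t0..} (J \<phi>)" for \<phi>
    by (rule continuous_on_vector_derivative) (use dJ in simp)
  have contP: "continuous_on UNIV (P \<phi>)" for \<phi>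
  proof -
    have W0: "W s \<noteq> 0" for s using Wpos[of s] by simp
    have 1: "continuous_on {t0..} (\<lambda>t. (1 / W t) *\<^sub>R J \<phi> t)"
      by (intro continuous_intros contW contJ ballI W0)
    have 2: "continuous_on UNIV (\<lambda>t. max t0 t)"
      by (intro continuous_intros)
    show ?thesis
      unfolding P_def by (rule continuous_on_compose2[OF 1 2]) auto
  qed
  have Plip: "norm (P \<phi> t - P \<psi> t) \<le> (1/2) * dist \<phi> \<psi>" for \<phi> \<psi> t
  proof -
    let ?t = "max t0 t"
    have "J \<phi> ?t - J \<psi> ?t = integral {t0..?t} (\<lambda>s. f s (y_of \<phi> s) - f s (y_of \<psi> s))"
      unfolding J_def
      by (intro Henstock_Kurzweil_Integration.integral_diff[symmetric] integrable_continuous_real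
          continuous_on_subset[OF contf]) auto
    also have "norm \<dots> \<le> dist \<phi> \<psi> * W ?t / 2"
    proof (rule int_bound)
      show "continuous_on {t0..} (\<lambda>s. f s (y_of \<phi> s) - f s (y_of \<psi> s))"
        by (intro continuous_intros contf)
      fix s assume s: "t0 \<le> s"
      have "norm (f s (y_of \<phi> s) - f s (y_of \<psi> s)) \<le> \<Lambda> s * norm (y_of \<phi> s - y_of \<psi> s)"
        by (rule lip[OF s])
      also have "y_of \<phi> s - y_of \<psi> s = W s *\<^sub>R (apply_bcontfun \<phi> s - apply_bcontfun \<psi> s)"
        by (simp add: y_of_def scaleR_diff_right)
      also have "norm \<dots> = W s * dist (apply_bcontfun \<phi> s) (apply_bcontfun \<psi> s)"
        using Wpos[of s] by (simp add: dist_norm)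
      also have "\<Lambda> s * \<dots> \<le> K s * (W s * dist \<phi> \<psi>)"
        using Wpos[of s] dist_bounded[of \<phi> s \<psi>] K0[of s]
        by (intro mult_mono) (auto simp: K_def intro: order_trans[OF abs_ge_self])
      finally show "norm (f s (y_of \<phi> s) - f s (y_of \<psi> s)) \<le> dist \<phi> \<psi> * (K s * W s)"
        by (simp add: mult_ac)
    qed auto
    finally have "norm (J \<phi> ?t - J \<psi> ?t) \<le> dist \<phi> \<psi> * W ?t / 2" .
    moreover have "norm (P \<phi> t - P \<psi> t) = norm (J \<phi> ?t - J \<psi> ?t) / W ?t"
      unfolding P_def scaleR_diff_right[symmetric] norm_scaleR using Wpos[of ?t] by simp
    ultimately show ?thesis
      using Wpos[of ?t] by (simp add: pos_divide_le_eq)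
  qed
  have P0: "norm (P 0 t) \<le> 1/2" for t
  proof -
    let ?t = "max t0 t"
    have "norm (J 0 ?t) \<le> 1 * W ?t / 2"
      unfolding J_def
    proof (rule int_bound)
      fix s assume "t0 \<le> s"
      have "norm (f s \<xi>) \<le> K s * 1" by (simp add: K_def)
      also have "\<dots> \<le> K s * W s" using K0 W1 by (intro mult_left_mono) auto
      finally show "norm (f s (y_of 0 s)) \<le> 1 * (K s * W s)" by (simp add: y_of_def)
    qed (auto intro: contf)
    moreover have "norm (P 0 t) = norm (J 0 ?t) / W ?t"
      unfolding P_def norm_scaleR using Wpos[of ?t] by simp
    ultimately show ?thesis
      using Wpos[of ?t] by (simp add: pos_divide_le_eq)
  qed
  have Pb: "P \<phi> \<in> bcontfun" for \<phi>
  proof (rule bcontfun_normI[OF contP])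
    fix t
    have "norm (P \<phi> t) \<le> norm (P \<phi> t - P 0 t) + norm (P 0 t)"
      by (metis add.commute norm_triangle_sub)
    then show "norm (P \<phi> t) \<le> (1/2) * dist \<phi> 0 + 1/2"
      using Plip[of \<phi> t 0] P0[of t] by linarith
  qed
  have "\<exists>!\<phi>. Bcontfun (P \<phi>) = \<phi>"
  proof (rule banach_fix_type[of "1/2"])
    show "\<forall>\<phi> \<psi>. dist (Bcontfun (P \<phi>)) (Bcontfun (P \<psi>)) \<le> 1/2 * dist \<phi> \<psi>"
    proof (intro allI dist_bound)
      fix \<phi> \<psi> t
      show "dist (apply_bcontfun (Bcontfun (P \<phi>)) t) (apply_bcontfun (Bcontfun (P \<psi>)) t)
        \<le> 1/2 * dist \<phi> \<psi>"
        unfolding Bcontfun_inverse[OF Pb] dist_norm[of "P \<phi> t"] by (rule Plip)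
    qed
  qed auto
  then obtain \<phi> where "Bcontfun (P \<phi>) = \<phi>" by blast
  then have fixp: "apply_bcontfun \<phi> = P \<phi>"
    by (metis Bcontfun_inverse Pb)
  have y_eq: "y_of \<phi> t = \<xi> + J \<phi> t" if "t0 \<le> t" for t
    using Wpos[of t] that by (simp add: y_of_def fixp P_def max_absorb2)
  have "solves_ode_from f t0 (y_of \<phi>)"
    unfolding solves_ode_from_def
  proof (intro allI impI)
    fix t assume t: "t0 \<le> t"
    have "((\<lambda>t. \<xi> + J \<phi> t) has_vector_derivative f t (y_of \<phi> t)) (at t within {t0..})"
      by (auto intro!: derivative_eq_intros dJ[OF t])
    then show "(y_of \<phi> has_vector_derivative f t (y_of \<phi> t)) (at t within {t0..})"
      by (rule has_vector_derivative_transform[rotated 2]) (use t y_eq in auto)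
  qed
  moreover have "y_of \<phi> t0 = \<xi>"
    using y_eq[of t0] by (simp add: J_def)
  ultimately show ?thesis by blast
qed

section \<open>The height correction\<close>

text \<open>
  The saturation clips the squared radius \<open>x1\<^sup>2 + x2\<^sup>2\<close>. It is more convenient to clip the radius
  itself, because this operation is non-expansive in \<open>(x1, x2)\<close>.
\<close>

definition clipped_radius :: "real \<Rightarrow> real \<Rightarrow> real \<Rightarrow> real" where
  "clipped_radius \<epsilon> x1 x2 = min (norm (x1, x2)) (sqrt (1 - \<epsilon>\<^sup>2))"

text \<open>
  The height of the unit sphere above \<open>(x1, x2)\<close>, after \<open>(x1, x2)\<close> has been moved
  radially to where the height is at least \<open>\<epsilon>\<close>.
\<close>

definition cap_height :: "real \<Rightarrow> real \<Rightarrow> real \<Rightarrow> real" where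
  "cap_height \<epsilon> x1 x2 = sqrt (1 - (clipped_radius \<epsilon> x1 x2)\<^sup>2)"

definition clamp_height :: "real \<Rightarrow> real \<Rightarrow> real" where
  "clamp_height M x = max (- M) (min M x)"

lemma clamp_height_id: "\<bar>x\<bar> \<le> M \<Longrightarrow> clamp_height M x = x"
  by (auto simp: clamp_height_def)

lemma norm_pair_square: "(norm (x1, x2))\<^sup>2 = x1\<^sup>2 + x2\<^sup>2" for x1 x2 :: real
  by (simp add: norm_Pair)

context
  fixes \<epsilon> :: real
  assumes eps: "0 < \<epsilon>" "\<epsilon> < 1"
begin

lemma one_minus_eps: "0 < 1 - \<epsilon>\<^sup>2" "1 - \<epsilon>\<^sup>2 < 1"
  using eps by (auto simp: power_less_one_iff)

lemma denominator_pos: "0 < x1\<^sup>2 + x2\<^sup>2 + 1 - \<epsilon>\<^sup>2"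
  using one_minus_eps(1) by (smt (verit) zero_le_power2)

lemma clipped_radius_square: "(clipped_radius \<epsilon> x1 x2)\<^sup>2 = min (x1\<^sup>2 + x2\<^sup>2) (1 - \<epsilon>\<^sup>2)"
proof -
  have "clipped_radius \<epsilon> x1 x2 = sqrt (min (x1\<^sup>2 + x2\<^sup>2) (1 - \<epsilon>\<^sup>2))"
    by (simp add: clipped_radius_def norm_Pair min_def)
  then show ?thesis
    using one_minus_eps(1) by simp
qed

lemma clipped_radius_nonneg: "0 \<le> clipped_radius \<epsilon> x1 x2"
  using one_minus_eps(1) by (simp add: clipped_radius_def)

lemma cap_height_bounds: "\<epsilon> \<le> cap_height \<epsilon> x1 x2" "cap_height \<epsilon> x1 x2 \<le> 1"
proof -
  show "\<epsilon> \<le> cap_height \<epsilon> x1 x2"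
    unfolding cap_height_def clipped_radius_square
    by (rule real_le_rsqrt) auto
  show "cap_height \<epsilon> x1 x2 \<le> 1"
    by (simp add: cap_height_def)
qed

lemma cap_height_square: "(cap_height \<epsilon> x1 x2)\<^sup>2 = 1 - (clipped_radius \<epsilon> x1 x2)\<^sup>2"
proof -
  have "(clipped_radius \<epsilon> x1 x2)\<^sup>2 \<le> 1"
    unfolding clipped_radius_square using one_minus_eps(2) by linarith
  then show ?thesis
    by (simp add: cap_height_def)
qed

lemma E_eq_cap_height:
  "E \<epsilon> x1 x2 x3 = (x3 - cap_height \<epsilon> x1 x2) / (x1\<^sup>2 + x2\<^sup>2 + 1 - \<epsilon>\<^sup>2)"
proof -
  define s where "s = x1\<^sup>2 + x2\<^sup>2"
  have s: "0 \<le> s" by (simp add: s_def)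
  have "sat \<epsilon> s = min s (1 - \<epsilon>\<^sup>2)"
  proof (cases "s = 0")
    case False
    then have "0 < s" using s by simp
    then show ?thesis
      by (auto simp: sat_def min_def field_simps)
  qed (use one_minus_eps in \<open>simp add: sat_def\<close>)
  then show ?thesis
    by (simp add: E_def cap_height_def clipped_radius_square s_def)
qed

lemma cap_height_on_cap:
  assumes "\<eta>1\<^sup>2 + \<eta>2\<^sup>2 + \<eta>3\<^sup>2 = 1" "\<epsilon> \<le> \<eta>3"
  shows "cap_height \<epsilon> \<eta>1 \<eta>2 = \<eta>3"
proof -
  have "\<epsilon>\<^sup>2 \<le> \<eta>3\<^sup>2" using assms(2) eps by (intro power_mono) auto
  then have "min (\<eta>1\<^sup>2 + \<eta>2\<^sup>2) (1 - \<epsilon>\<^sup>2) = 1 - \<eta>3\<^sup>2" using assms(1) by simp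
  then show ?thesis
    using assms(2) eps by (simp add: cap_height_def clipped_radius_square)
qed

text \<open>
  The difference of two heights is the difference of the squared radii divided by the sum of the
  heights, which is at least \<open>2 \<epsilon>\<close>. The sum of the radii is kept as a factor: the square of a
  clipped radius is at most \<open>1 - \<epsilon>\<^sup>2\<close>, the least value of the denominator of \<open>E\<close>.
\<close>

lemma cap_height_diff:
  "\<bar>cap_height \<epsilon> x1 x2 - cap_height \<epsilon> y1 y2\<bar>
    \<le> (clipped_radius \<epsilon> x1 x2 + clipped_radius \<epsilon> y1 y2) / (2 * \<epsilon>) * norm (x1 - y1, x2 - y2)"
proof -
  let ?h = "cap_height \<epsilon> x1 x2" and ?k = "cap_height \<epsilon> y1 y2"
  let ?a = "clipped_radius \<epsilon> x1 x2" and ?b = "clipped_radius \<epsilon> y1 y2"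
  let ?n = "norm (x1 - y1, x2 - y2)"
  have sq: "(?h - ?k) * (?h + ?k) = (?b - ?a) * (?a + ?b)"
    using cap_height_square[of x1 x2] cap_height_square[of y1 y2]
    by (simp add: algebra_simps power2_eq_square)
  have "\<bar>norm (x1, x2) - norm (y1, y2)\<bar> \<le> ?n"
    using norm_triangle_ineq3[of "(x1, x2)" "(y1, y2)"] by simp
  then have ab: "\<bar>?b - ?a\<bar> \<le> ?n"
    unfolding clipped_radius_def by linarith
  have "\<bar>?h - ?k\<bar> * (2 * \<epsilon>) \<le> \<bar>?h - ?k\<bar> * (?h + ?k)"
    using cap_height_bounds[of x1 x2] cap_height_bounds[of y1 y2]
    by (intro mult_left_mono) auto
  also have "\<dots> = \<bar>(?h - ?k) * (?h + ?k)\<bar>"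
    using cap_height_bounds[of x1 x2] cap_height_bounds[of y1 y2] eps by (simp add: abs_mult)
  also have "\<dots> = \<bar>?b - ?a\<bar> * (?a + ?b)"
    using clipped_radius_nonneg by (simp add: sq abs_mult)
  also have "\<dots> \<le> ?n * (?a + ?b)"
    using clipped_radius_nonneg by (intro mult_right_mono ab) auto
  finally show ?thesis
    using eps by (simp add: field_simps)
qed

text \<open>
  Write the numerator of \<open>E\<close> as \<open>z3 + d\<close>, where \<open>d\<close> is a difference of two heights. Then
  \<open>- z3 (z3 + d)\<close> is at most \<open>d\<^sup>2 / 2 - z3\<^sup>2 / 2\<close>, and \<open>d\<^sup>2\<close> is at most
  \<open>(a + b)\<^sup>2 (z1\<^sup>2 + z2\<^sup>2) / (4 \<epsilon>\<^sup>2)\<close> for the two clipped radii \<open>a\<close> and \<open>b\<close>. Since \<open>a\<^sup>2\<close> and \<open>b\<^sup>2\<close>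
  are at most \<open>1 - \<epsilon>\<^sup>2\<close>, the factor \<open>(a + b)\<^sup>2\<close> is at most four times the denominator of \<open>E\<close>.
  Division by the denominator leaves a bound whose first part is global in \<open>z\<close>.
\<close>

lemma E_dissipation:
  assumes "\<eta>1\<^sup>2 + \<eta>2\<^sup>2 + \<eta>3\<^sup>2 = 1" "\<epsilon> \<le> \<eta>3"
  shows "- z3 * E \<epsilon> (\<eta>1 + z1) (\<eta>2 + z2) (\<eta>3 + z3)
    \<le> (z1\<^sup>2 + z2\<^sup>2) / (2 * \<epsilon>\<^sup>2) - z3\<^sup>2 / (2 * ((\<eta>1 + z1)\<^sup>2 + (\<eta>2 + z2)\<^sup>2 + 1 - \<epsilon>\<^sup>2))"
proof -
  define D where "D = (\<eta>1 + z1)\<^sup>2 + (\<eta>2 + z2)\<^sup>2 + 1 - \<epsilon>\<^sup>2"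
  define a where "a = clipped_radius \<epsilon> \<eta>1 \<eta>2"
  define b where "b = clipped_radius \<epsilon> (\<eta>1 + z1) (\<eta>2 + z2)"
  define d where "d = \<eta>3 - cap_height \<epsilon> (\<eta>1 + z1) (\<eta>2 + z2)"
  have D: "D > 0" unfolding D_def by (rule denominator_pos)
  have "\<bar>d\<bar> \<le> (a + b) / (2 * \<epsilon>) * norm (z1, z2)"
    using cap_height_diff[of \<eta>1 \<eta>2 "\<eta>1 + z1" "\<eta>2 + z2"] cap_height_on_cap[OF assms]
    by (simp add: d_def a_def b_def norm_Pair)
  then have "\<bar>d\<bar>\<^sup>2 \<le> ((a + b) / (2 * \<epsilon>) * norm (z1, z2))\<^sup>2"
    by (rule power_mono) simp
  then have "d\<^sup>2 \<le> (a + b)\<^sup>2 * ((z1\<^sup>2 + z2\<^sup>2) / (4 * \<epsilon>\<^sup>2))"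
    by (simp add: power_mult_distrib power_divide norm_pair_square)
  also have "\<dots> \<le> (4 * D) * ((z1\<^sup>2 + z2\<^sup>2) / (4 * \<epsilon>\<^sup>2))"
  proof (rule mult_right_mono)
    have "(a + b)\<^sup>2 \<le> 2 * a\<^sup>2 + 2 * b\<^sup>2"
      using sum_squares_bound[of a b] by (simp add: power2_sum)
    also have "\<dots> \<le> 2 * (1 - \<epsilon>\<^sup>2) + 2 * (1 - \<epsilon>\<^sup>2)"
      unfolding a_def b_def clipped_radius_square by (intro add_mono mult_left_mono) auto
    also have "\<dots> \<le> 4 * D"
      by (simp add: D_def)
    finally show "(a + b)\<^sup>2 \<le> 4 * D" .
  qed simp
  finally have d2: "d\<^sup>2 / 2 \<le> D * ((z1\<^sup>2 + z2\<^sup>2) / (2 * \<epsilon>\<^sup>2))" by simp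
  have "- z3 * (z3 + d) \<le> d\<^sup>2 / 2 - z3\<^sup>2 / 2"
  proof -
    have "d\<^sup>2 / 2 - z3\<^sup>2 / 2 + z3 * (z3 + d) = (z3 + d)\<^sup>2 / 2"
      by (simp add: power2_eq_square field_simps)
    moreover have "0 \<le> (z3 + d)\<^sup>2 / 2" by simp
    ultimately show ?thesis by linarith
  qed
  then have "- z3 * (z3 + d) \<le> D * ((z1\<^sup>2 + z2\<^sup>2) / (2 * \<epsilon>\<^sup>2)) - z3\<^sup>2 / 2"
    using d2 by linarith
  then have "- z3 * (z3 + d) / D \<le> (D * ((z1\<^sup>2 + z2\<^sup>2) / (2 * \<epsilon>\<^sup>2)) - z3\<^sup>2 / 2) / D"
    using D by (intro divide_right_mono) auto
  also have "\<dots> = (z1\<^sup>2 + z2\<^sup>2) / (2 * \<epsilon>\<^sup>2) - z3\<^sup>2 / (2 * D)"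
    using D by (simp add: diff_divide_distrib)
  finally have "- z3 * ((z3 + d) / D) \<le> (z1\<^sup>2 + z2\<^sup>2) / (2 * \<epsilon>\<^sup>2) - z3\<^sup>2 / (2 * D)"
    by simp
  moreover have "E \<epsilon> (\<eta>1 + z1) (\<eta>2 + z2) (\<eta>3 + z3) = (z3 + d) / D"
    by (simp add: E_eq_cap_height D_def d_def)
  ultimately show ?thesis unfolding D_def by simp
qed

text \<open>
  When the clamp is active, the clamped height is \<open>M\<close> or \<open>- M\<close> and lies on the same side of all
  heights in \<open>[0, 1]\<close> as \<open>\<eta>3 + z3\<close>. The correction is then never opposite in sign to \<open>z3\<close>.
\<close>

lemma E_clamped_dissipation:
  assumes "\<eta>1\<^sup>2 + \<eta>2\<^sup>2 + \<eta>3\<^sup>2 = 1" "\<epsilon> \<le> \<eta>3" "1 \<le> M"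
  shows "- z3 * E \<epsilon> (\<eta>1 + z1) (\<eta>2 + z2) (clamp_height M (\<eta>3 + z3)) \<le> (z1\<^sup>2 + z2\<^sup>2) / (2 * \<epsilon>\<^sup>2)"
proof -
  let ?D = "(\<eta>1 + z1)\<^sup>2 + (\<eta>2 + z2)\<^sup>2 + 1 - \<epsilon>\<^sup>2"
  have D: "?D > 0" by (rule denominator_pos)
  have h: "\<epsilon> \<le> cap_height \<epsilon> (\<eta>1 + z1) (\<eta>2 + z2)" "cap_height \<epsilon> (\<eta>1 + z1) (\<eta>2 + z2) \<le> 1"
    by (rule cap_height_bounds)+
  have rhs: "0 \<le> (z1\<^sup>2 + z2\<^sup>2) / (2 * \<epsilon>\<^sup>2)" by simp
  have "\<eta>3\<^sup>2 \<le> 1" using assms(1) by (smt (verit) zero_le_power2)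
  then have eta: "\<bar>\<eta>3\<bar> \<le> 1" by (simp add: abs_square_le_1)
  consider "\<bar>\<eta>3 + z3\<bar> \<le> M" | "\<eta>3 + z3 > M" | "\<eta>3 + z3 < - M" by linarith
  then show ?thesis
  proof cases
    case 1
    then have "clamp_height M (\<eta>3 + z3) = \<eta>3 + z3"
      unfolding clamp_height_def by linarith
    moreover have "0 \<le> z3\<^sup>2 / (2 * ?D)" using D by simp
    ultimately show ?thesis using E_dissipation[OF assms(1,2), of z3 z1 z2] by simp
  next
    case 2
    then have clamped: "clamp_height M (\<eta>3 + z3) = M" and "0 \<le> z3"
      using eta assms(3) unfolding clamp_height_def by linarith+
    then have nonneg: "0 \<le> z3 * E \<epsilon> (\<eta>1 + z1) (\<eta>2 + z2) M"
      unfolding E_eq_cap_height using D h assms(3)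
      by (intro mult_nonneg_nonneg divide_nonneg_pos) auto
    show ?thesis
      unfolding clamped by (rule order_trans[OF _ rhs]) (use nonneg in simp)
  next
    case 3
    then have clamped: "clamp_height M (\<eta>3 + z3) = - M" and "z3 \<le> 0"
      using eta assms(3) unfolding clamp_height_def by linarith+
    then have nonneg: "0 \<le> z3 * E \<epsilon> (\<eta>1 + z1) (\<eta>2 + z2) (- M)"
      unfolding E_eq_cap_height using D h assms(3) eps
      by (intro mult_nonpos_nonpos divide_nonpos_pos) auto
    show ?thesis
      unfolding clamped by (rule order_trans[OF _ rhs]) (use nonneg in simp)
  qed
qed

text \<open>
  The numerator is Lipschitz and, thanks to the clamp, bounded. The reciprocal of the denominator
  is Lipschitz because the increment of \<open>x1\<^sup>2 + x2\<^sup>2\<close> grows only linearly in the coordinates, and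
  each coordinate is dominated by the denominator.
\<close>

lemma E_clamped_Lipschitz:
  assumes "1 \<le> M"
  shows "\<exists>C\<ge>0. \<forall>x1 x2 x3 y1 y2 y3 n.
    \<bar>x1 - y1\<bar> \<le> n \<and> \<bar>x2 - y2\<bar> \<le> n \<and> \<bar>x3 - y3\<bar> \<le> n \<longrightarrow>
    \<bar>E \<epsilon> x1 x2 (clamp_height M x3) - E \<epsilon> y1 y2 (clamp_height M y3)\<bar> \<le> C * n"
proof -
  define m where "m = 1 - \<epsilon>\<^sup>2"
  have m: "0 < m" "m < 1" unfolding m_def by (rule one_minus_eps)+
  define C where "C = (1 + 2 / \<epsilon>) / m + (M + 1) * (4 / m\<^sup>2)"
  show ?thesis
  proof (intro exI[of _ C] conjI allI impI)
    show "0 \<le> C" using m eps assms by (simp add: C_def)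
    fix x1 x2 x3 y1 y2 y3 n :: real
    assume n: "\<bar>x1 - y1\<bar> \<le> n \<and> \<bar>x2 - y2\<bar> \<le> n \<and> \<bar>x3 - y3\<bar> \<le> n"
    then have n0: "0 \<le> n" by linarith
    define D where "D = x1\<^sup>2 + x2\<^sup>2 + m"
    define D' where "D' = y1\<^sup>2 + y2\<^sup>2 + m"
    define N where "N = clamp_height M x3 - cap_height \<epsilon> x1 x2"
    define N' where "N' = clamp_height M y3 - cap_height \<epsilon> y1 y2"
    have Dm: "m \<le> D" "m \<le> D'" by (auto simp: D_def D'_def)
    have D0: "0 < D" "0 < D'" using Dm m by auto
    \<comment> \<open>As \<open>m < 1\<close>, the denominator \<open>s + m\<close> is at least \<open>m (1 + s)\<close>, hence at least \<open>m \<bar>x\<bar>\<close>.\<close>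
    have coord: "\<bar>x\<bar> \<le> (s + m) / m" if "x\<^sup>2 \<le> s" for x s :: real
    proof -
      have "\<bar>x\<bar> \<le> 1 + x\<^sup>2"
        using sum_squares_bound[of "\<bar>x\<bar>" 1] zero_le_power2[of x] unfolding power2_abs power_one
        by linarith
      then have "\<bar>x\<bar> * m \<le> (1 + s) * m" using that m by (intro mult_right_mono) auto
      also have "\<dots> \<le> s + m" using m that mult_left_le[of m s]
        by (simp add: algebra_simps) (smt (verit) zero_le_power2)
      finally show ?thesis using m by (simp add: field_simps)
    qed
    have x: "\<bar>x1\<bar> \<le> D / m" "\<bar>x2\<bar> \<le> D / m" "\<bar>y1\<bar> \<le> D' / m" "\<bar>y2\<bar> \<le> D' / m"
      unfolding D_def D'_def by (auto intro!: coord)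
    have DD: "D / m \<le> D * D' / m\<^sup>2" "D' / m \<le> D * D' / m\<^sup>2"
    proof -
      have "1 \<le> D / m" "1 \<le> D' / m"
        using Dm m by simp_all
      then have "D / m * 1 \<le> D / m * (D' / m)" "D' / m * 1 \<le> D' / m * (D / m)"
        by (intro mult_left_mono; simp)+
      then show "D / m \<le> D * D' / m\<^sup>2" "D' / m \<le> D * D' / m\<^sup>2"
        by (simp_all add: power2_eq_square mult_ac)
    qed
    have sqd: "\<bar>x\<^sup>2 - y\<^sup>2\<bar> \<le> 2 * (D * D' / m\<^sup>2) * n"
      if "\<bar>x\<bar> \<le> D / m" "\<bar>y\<bar> \<le> D' / m" "\<bar>x - y\<bar> \<le> n" for x y
    proof -
      have "\<bar>x\<^sup>2 - y\<^sup>2\<bar> = \<bar>x + y\<bar> * \<bar>x - y\<bar>"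
        by (simp add: abs_mult[symmetric] power2_eq_square algebra_simps)
      also have "\<dots> \<le> (2 * (D * D' / m\<^sup>2)) * n"
        using that DD D0 by (intro mult_mono) auto
      finally show ?thesis .
    qed
    have dD: "\<bar>D' - D\<bar> \<le> 4 * (D * D' / m\<^sup>2) * n"
      using sqd[OF x(1,3)] sqd[OF x(2,4)] n unfolding D_def D'_def by linarith
    have dN: "\<bar>N - N'\<bar> \<le> (1 + 2 / \<epsilon>) * n"
    proof -
      have ra: "clipped_radius \<epsilon> a b \<le> 1" for a b
        unfolding clipped_radius_def using one_minus_eps by (intro min.coboundedI2) auto
      have "norm (x1 - y1, x2 - y2) \<le> 2 * n"
        using norm_Pair_le[of "x1 - y1" "x2 - y2"] n by simp
      then have "(clipped_radius \<epsilon> x1 x2 + clipped_radius \<epsilon> y1 y2) / (2 * \<epsilon>) * norm (x1 - y1, x2 - y2)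
          \<le> 2 / (2 * \<epsilon>) * (2 * n)"
        using ra[of x1 x2] ra[of y1 y2] eps clipped_radius_nonneg n0
        by (intro mult_mono divide_right_mono) auto
      then have "\<bar>cap_height \<epsilon> x1 x2 - cap_height \<epsilon> y1 y2\<bar> \<le> 2 / \<epsilon> * n"
        using cap_height_diff[of x1 x2 y1 y2] by simp
      moreover have "\<bar>clamp_height M x3 - clamp_height M y3\<bar> \<le> n"
        using n unfolding clamp_height_def by linarith
      ultimately show ?thesis
        unfolding N_def N'_def by (simp add: distrib_right)
    qed
    have N': "\<bar>N'\<bar> \<le> M + 1"
      using cap_height_bounds[of y1 y2] eps assms unfolding N'_def clamp_height_def by linarith
    have "E \<epsilon> x1 x2 (clamp_height M x3) - E \<epsilon> y1 y2 (clamp_height M y3) = N / D - N' / D'"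
      by (simp add: E_eq_cap_height N_def D_def N'_def D'_def m_def algebra_simps)
    also have "\<dots> = (N - N') / D + N' * ((D' - D) / (D * D'))"
      using D0 by (simp add: field_simps)
    also have "\<bar>\<dots>\<bar> \<le> \<bar>(N - N') / D\<bar> + \<bar>N' * ((D' - D) / (D * D'))\<bar>"
      by (rule abs_triangle_ineq)
    also have "\<dots> \<le> (1 + 2 / \<epsilon>) * n / m + (M + 1) * (4 / m\<^sup>2 * n)"
    proof (rule add_mono)
      show "\<bar>(N - N') / D\<bar> \<le> (1 + 2 / \<epsilon>) * n / m"
        using dN Dm m D0 by (simp add: abs_div_pos[symmetric]) (intro frac_le, auto)
      show "\<bar>N' * ((D' - D) / (D * D'))\<bar> \<le> (M + 1) * (4 / m\<^sup>2 * n)"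
        unfolding abs_mult
      proof (rule mult_mono[OF N'])
        show "\<bar>(D' - D) / (D * D')\<bar> \<le> 4 / m\<^sup>2 * n"
          using dD D0 by (simp add: abs_divide abs_mult pos_divide_le_eq mult_ac)
      qed (use assms in auto)
    qed
    also have "\<dots> = C * n"
      by (simp add: C_def algebra_simps add_divide_distrib)
    finally show "\<bar>E \<epsilon> x1 x2 (clamp_height M x3) - E \<epsilon> y1 y2 (clamp_height M y3)\<bar> \<le> C * n" .
  qed
qed

end

lemma continuous_on_E_clamped:
  assumes "0 < \<epsilon>" "\<epsilon> < 1"
    and "continuous_on S f1" "continuous_on S f2" "continuous_on S f3"
  shows "continuous_on S (\<lambda>s. E \<epsilon> (f1 s) (f2 s) (clamp_height M (f3 s)))"
proof -
  have "(f1 s)\<^sup>2 + (f2 s)\<^sup>2 + 1 - \<epsilon>\<^sup>2 \<noteq> 0" for s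
    using denominator_pos[OF assms(1,2), of "f1 s" "f2 s"] by simp
  then show ?thesis
    unfolding E_eq_cap_height[OF assms(1,2)] cap_height_def clipped_radius_def clamp_height_def
    by (intro continuous_intros assms ballI)
qed

section \<open>The error system\<close>

text \<open>
  A correction term as a function of time and of the last three error coordinates. The error
  system is studied for an arbitrary one, so that the original and the clamped term are treated
  alike.
\<close>

type_synonym injection = "real \<Rightarrow> real \<Rightarrow> real \<Rightarrow> real \<Rightarrow> real"

definition error_field ::
    "real \<Rightarrow> real \<Rightarrow> real \<Rightarrow> real \<Rightarrow> real \<Rightarrow> real
     \<Rightarrow> (real \<Rightarrow> real) \<Rightarrow> (real \<Rightarrow> real) \<Rightarrow> (real \<Rightarrow> real) \<Rightarrow> (real \<Rightarrow> real)
     \<Rightarrow> injection \<Rightarrow> real \<Rightarrow> state \<Rightarrow> state" where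
  "error_field g k1 k2 k3 ku kv p q r c N t = (\<lambda>(a, b, z1, z2, z3).
     (g * z1 - (c t + ku) * a,
      g * z2 - (c t + kv) * b,
      r t * z2 - q t * z3 - k1 * z1 + k1 * c t / g * a,
      p t * z3 - r t * z1 - k2 * z2 + k2 * c t / g * b,
      q t * z1 - p t * z2 - k3 * N t z1 z2 z3))"

text \<open>
  With \<open>\<kappa>1 = k1 / g\<close> and \<open>\<kappa>2 = k2 / g\<close> this leads from the coordinates \<open>(a, b, z1, z2, z3)\<close> to
  the estimation error. The inverse has the signs of \<open>\<kappa>1\<close> and \<open>\<kappa>2\<close> reversed.
\<close>

definition shear :: "real \<Rightarrow> real \<Rightarrow> state \<Rightarrow> state" where
  "shear \<kappa>1 \<kappa>2 = (\<lambda>(a, b, z1, z2, z3). (a, b, z1 + \<kappa>1 * a, z2 + \<kappa>2 * b, z3))"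

lemma abs_components_le_norm:
  fixes a b z1 z2 z3 :: real
  shows "\<bar>a\<bar> \<le> norm (a, b, z1, z2, z3)" "\<bar>b\<bar> \<le> norm (a, b, z1, z2, z3)"
    "\<bar>z1\<bar> \<le> norm (a, b, z1, z2, z3)" "\<bar>z2\<bar> \<le> norm (a, b, z1, z2, z3)"
    "\<bar>z3\<bar> \<le> norm (a, b, z1, z2, z3)"
  using norm_fst_le[of a "(b, z1, z2, z3)"] norm_snd_le[of "(b, z1, z2, z3)" a]
    norm_fst_le[of b "(z1, z2, z3)"] norm_snd_le[of "(z1, z2, z3)" b]
    norm_fst_le[of z1 "(z2, z3)"] norm_snd_le[of "(z2, z3)" z1]
    norm_fst_le[of z2 z3] norm_snd_le[of z3 z2]
  unfolding real_norm_def by linarith+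

lemma norm_le_sum_components:
  fixes a b z1 z2 z3 :: real
  shows "norm (a, b, z1, z2, z3) \<le> \<bar>a\<bar> + \<bar>b\<bar> + \<bar>z1\<bar> + \<bar>z2\<bar> + \<bar>z3\<bar>"
  using norm_Pair_le[of a "(b, z1, z2, z3)"] norm_Pair_le[of b "(z1, z2, z3)"]
    norm_Pair_le[of z1 "(z2, z3)"] norm_Pair_le[of z2 z3]
  by simp

lemma norm_state_square:
  fixes a b z1 z2 z3 :: real
  shows "(norm (a, b, z1, z2, z3))\<^sup>2 = a\<^sup>2 + b\<^sup>2 + z1\<^sup>2 + z2\<^sup>2 + z3\<^sup>2"
  by (simp add: norm_Pair)

lemma shear_inverse: "shear \<kappa>1 \<kappa>2 (shear (- \<kappa>1) (- \<kappa>2) z) = z"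
  by (auto simp: shear_def split: prod.splits)

lemma norm_shear: "norm (shear \<kappa>1 \<kappa>2 z) \<le> (1 + \<bar>\<kappa>1\<bar> + \<bar>\<kappa>2\<bar>) * norm z"
proof -
  obtain a b z1 z2 z3 where z: "z = (a, b, z1, z2, z3)" by (cases z)
  have "shear \<kappa>1 \<kappa>2 z = z + (0, 0, \<kappa>1 * a, \<kappa>2 * b, 0)"
    by (simp add: shear_def z)
  also have "norm \<dots> \<le> norm z + (\<bar>\<kappa>1\<bar> * \<bar>a\<bar> + \<bar>\<kappa>2\<bar> * \<bar>b\<bar>)"
    using norm_le_sum_components[of 0 0 "\<kappa>1 * a" "\<kappa>2 * b" 0]
    by (intro norm_triangle_mono) (simp_all add: abs_mult)
  also have "\<dots> \<le> norm z + (\<bar>\<kappa>1\<bar> * norm z + \<bar>\<kappa>2\<bar> * norm z)"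
    unfolding z by (intro add_mono mult_left_mono abs_components_le_norm) auto
  finally show ?thesis by (simp add: algebra_simps)
qed

lemma bounded_linear_shear: "bounded_linear (shear \<kappa>1 \<kappa>2)"
proof (rule bounded_linear_intro)
  show "norm (shear \<kappa>1 \<kappa>2 z) \<le> norm z * (1 + \<bar>\<kappa>1\<bar> + \<bar>\<kappa>2\<bar>)" for z
    using norm_shear[of \<kappa>1 \<kappa>2 z] by (simp add: mult.commute)
  show "shear \<kappa>1 \<kappa>2 (z + w) = shear \<kappa>1 \<kappa>2 z + shear \<kappa>1 \<kappa>2 w" for z w
    by (cases z; cases w) (simp add: shear_def distrib_left)
  show "shear \<kappa>1 \<kappa>2 (s *\<^sub>R z) = s *\<^sub>R shear \<kappa>1 \<kappa>2 z" for s z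
    by (cases z) (simp add: shear_def distrib_left mult.left_commute)
qed

text \<open>
  The accelerometers reveal the velocity: \<open>ax / c = - u\<close>, so the output error fed back by the
  observer is \<open>a\<close>. Gravity puts the term \<open>g z1\<close> into the derivative of \<open>a\<close>, and so the
  subtraction of \<open>(k1 / g) a\<close> from the attitude error gives \<open>z1\<close> the damping \<open>- k1 z1\<close>.
\<close>

lemma observer_field_eq_error_field:
  assumes "0 < g" "0 < c t" "ax t = - c t * u" "ay t = - c t * v"
  shows "observer_field \<epsilon> g k1 k2 k3 ku kv p q r c ax ay t
      ((u, v, \<eta>1, \<eta>2, \<eta>3) + shear (k1 / g) (k2 / g) z)
    = design_field g p q r c t (u, v, \<eta>1, \<eta>2, \<eta>3)
      + shear (k1 / g) (k2 / g)
          (error_field g k1 k2 k3 ku kv p q r c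
            (\<lambda>_ z1 z2 z3. E \<epsilon> (\<eta>1 + z1) (\<eta>2 + z2) (\<eta>3 + z3)) t z)"
proof -
  obtain a b z1 z2 z3 where z: "z = (a, b, z1, z2, z3)" by (cases z)
  obtain \<kappa>1 \<kappa>2 where k: "k1 = g * \<kappa>1" "k2 = g * \<kappa>2"
    using assms(1) by (metis nonzero_mult_div_cancel_left less_irrefl times_divide_eq_right)
  have div_g: "g * x / g = x" "g * x * y / g = x * y" "y * (g * x) / g = y * x" for x y
    using assms(1) by simp_all
  have y: "u + a + ax t / c t = a" "v + b + ay t / c t = b"
    using assms by simp_all
  have inputs: "\<eta>1 + (z1 + \<kappa>1 * a) - \<kappa>1 * a = \<eta>1 + z1"
    "\<eta>2 + (z2 + \<kappa>2 * b) - \<kappa>2 * b = \<eta>2 + z2" by simp_all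
  show ?thesis
    unfolding z observer_field_def design_field_def error_field_def shear_def Let_def
      prod.case add_Pair y k div_g inputs
    by (simp add: algebra_simps)
qed

text \<open>
  In \<open>z \<bullet> z'\<close> the angular velocities cancel. Both couplings of \<open>a\<close> with \<open>z1\<close>, through gravity and
  through drag, are bounded by Young's inequality so that each costs one half of \<open>z1\<^sup>2\<close>, and
  the costs in \<open>a\<^sup>2\<close> add up to the threshold for \<open>ku\<close>; likewise for \<open>b\<close> and \<open>z2\<close>. The parameter
  \<open>\<sigma>\<close> measures the damping that the correction provides for \<open>z3\<close>.
\<close>

lemma error_field_dissipation:
  fixes z :: state
  assumes "z = (a, b, z1, z2, z3)" "0 < g" "0 < k3" "0 < c t" "c t \<le> c_u"
    and inj: "- z3 * N t z1 z2 z3 \<le> (z1\<^sup>2 + z2\<^sup>2) / (2 * \<epsilon>\<^sup>2) - \<sigma> * z3\<^sup>2"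
  shows "inner z (error_field g k1 k2 k3 ku kv p q r c N t z)
    \<le> - ((ku - (k1\<^sup>2 * c_u\<^sup>2 / (2 * g\<^sup>2) + g\<^sup>2 / 2)) * a\<^sup>2
        + (kv - (k2\<^sup>2 * c_u\<^sup>2 / (2 * g\<^sup>2) + g\<^sup>2 / 2)) * b\<^sup>2
        + (k1 - (1 + k3 / (2 * \<epsilon>\<^sup>2))) * z1\<^sup>2 + (k2 - (1 + k3 / (2 * \<epsilon>\<^sup>2))) * z2\<^sup>2
        + k3 * \<sigma> * z3\<^sup>2)"
proof -
  have young: "x * y \<le> x\<^sup>2 / 2 + y\<^sup>2 / 2" for x y :: real
    using sum_squares_bound[of x y] by simp
  have cross: "k * c t / g * a * z \<le> k\<^sup>2 * c_u\<^sup>2 / (2 * g\<^sup>2) * a\<^sup>2 + z\<^sup>2 / 2" for k a z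
  proof -
    have "k * c t / g * a * z \<le> (k * c t / g * a)\<^sup>2 / 2 + z\<^sup>2 / 2"
      by (rule young)
    also have "(k * c t / g * a)\<^sup>2 / 2 = (c t)\<^sup>2 * (k\<^sup>2 / (2 * g\<^sup>2) * a\<^sup>2)"
      by (simp add: power_mult_distrib power_divide mult_ac)
    also have "\<dots> \<le> c_u\<^sup>2 * (k\<^sup>2 / (2 * g\<^sup>2) * a\<^sup>2)"
      using assms by (intro mult_right_mono power_mono) auto
    finally show ?thesis by (simp add: mult_ac)
  qed
  have gr: "g * a * z \<le> g\<^sup>2 / 2 * a\<^sup>2 + z\<^sup>2 / 2" for a z
    using young[of "g * a" z] by (simp add: power_mult_distrib)
  define A1 where "A1 = k1\<^sup>2 * c_u\<^sup>2 / (2 * g\<^sup>2)"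
  define A2 where "A2 = k2\<^sup>2 * c_u\<^sup>2 / (2 * g\<^sup>2)"
  define h where "h = k3 / (2 * \<epsilon>\<^sup>2)"
  have "k3 * (- z3 * N t z1 z2 z3) \<le> k3 * ((z1\<^sup>2 + z2\<^sup>2) / (2 * \<epsilon>\<^sup>2) - \<sigma> * z3\<^sup>2)"
    using inj assms(3) by (intro mult_left_mono) auto
  also have "\<dots> = h * z1\<^sup>2 + h * z2\<^sup>2 - k3 * \<sigma> * z3\<^sup>2"
    by (simp add: h_def right_diff_distrib distrib_left add_divide_distrib)
  finally have corr: "k3 * (- z3 * N t z1 z2 z3) \<le> h * z1\<^sup>2 + h * z2\<^sup>2 - k3 * \<sigma> * z3\<^sup>2" .
  have drag: "0 \<le> c t * a\<^sup>2" "0 \<le> c t * b\<^sup>2"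
    using assms by auto
  have "inner z (error_field g k1 k2 k3 ku kv p q r c N t z)
    = g * a * z1 + k1 * c t / g * a * z1 - c t * a\<^sup>2 - ku * a\<^sup>2 - k1 * z1\<^sup>2
      + (g * b * z2 + k2 * c t / g * b * z2 - c t * b\<^sup>2 - kv * b\<^sup>2 - k2 * z2\<^sup>2)
      + k3 * (- z3 * N t z1 z2 z3)"
    unfolding assms(1) by (simp add: error_field_def algebra_simps power2_eq_square)
  also have "\<dots> \<le> (g\<^sup>2 / 2 * a\<^sup>2 + z1\<^sup>2 / 2) + (A1 * a\<^sup>2 + z1\<^sup>2 / 2) - ku * a\<^sup>2 - k1 * z1\<^sup>2
      + ((g\<^sup>2 / 2 * b\<^sup>2 + z2\<^sup>2 / 2) + (A2 * b\<^sup>2 + z2\<^sup>2 / 2) - kv * b\<^sup>2 - k2 * z2\<^sup>2)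
      + (h * z1\<^sup>2 + h * z2\<^sup>2 - k3 * \<sigma> * z3\<^sup>2)"
    using gr[of a z1] gr[of b z2] cross[of k1 a z1] cross[of k2 b z2] corr drag
    unfolding A1_def[symmetric] A2_def[symmetric] by linarith
  also have "\<dots> = - ((ku - (A1 + g\<^sup>2 / 2)) * a\<^sup>2 + (kv - (A2 + g\<^sup>2 / 2)) * b\<^sup>2
      + (k1 - (1 + h)) * z1\<^sup>2 + (k2 - (1 + h)) * z2\<^sup>2 + k3 * \<sigma> * z3\<^sup>2)"
    by (simp add: left_diff_distrib distrib_right)
  finally show ?thesis
    unfolding A1_def A2_def h_def .
qed

text \<open>
  The function \<open>exp (2 \<beta> (s - t0)) |z s|\<^sup>2\<close> is non-increasing. For \<open>\<beta> = 0\<close> this says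
  that the norm does not increase.
\<close>

lemma norm_decay_of_dissipative:
  fixes z :: "real \<Rightarrow> 'a::real_inner"
  assumes sol: "solves_ode_from G t0 z" and "t0 \<le> t"
    and diss: "\<And>s. t0 \<le> s \<Longrightarrow> inner (z s) (G s (z s)) \<le> - \<beta> * (norm (z s))\<^sup>2"
  shows "norm (z t) \<le> exp (- \<beta> * (t - t0)) * norm (z t0)"
proof -
  define w where "w s = exp (2 * \<beta> * (s - t0)) * inner (z s) (z s)" for s
  have dw: "(w has_real_derivative
      exp (2 * \<beta> * (s - t0)) * (2 * \<beta> * inner (z s) (z s) + 2 * inner (z s) (G s (z s))))
      (at s within {t0..})" if "t0 \<le> s" for s
  proof -
    have "(z has_vector_derivative G s (z s)) (at s within {t0..})"
      using sol that by (auto simp: solves_ode_from_def)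
    then have "((\<lambda>s. inner (z s) (z s)) has_vector_derivative
        inner (z s) (G s (z s)) + inner (G s (z s)) (z s)) (at s within {t0..})"
      by (intro bounded_bilinear.has_vector_derivative[OF bounded_bilinear_inner])
    then have "((\<lambda>s. inner (z s) (z s)) has_real_derivative
        2 * inner (z s) (G s (z s))) (at s within {t0..})"
      by (simp add: has_real_derivative_iff_has_vector_derivative inner_commute)
    then show ?thesis
      unfolding w_def by (auto intro!: derivative_eq_intros simp: algebra_simps)
  qed
  have "w t \<le> w t0"
  proof (cases "t = t0")
    case False
    show ?thesis
    proof (rule DERIV_nonpos_imp_decreasing_open[where f=w and a=t0 and b=t])
      show "t0 \<le> t" by fact
      show "continuous_on {t0..t} w"
        by (rule DERIV_continuous_on[OF DERIV_subset[OF dw]]) auto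
      fix s assume s: "t0 < s" "s < t"
      have "at s within {t0..} = at s"
        by (rule at_within_interior) (use s in simp)
      moreover have "exp (2 * \<beta> * (s - t0)) * (2 * \<beta> * inner (z s) (z s) + 2 * inner (z s) (G s (z s))) \<le> 0"
        using diss[of s] s by (intro mult_nonneg_nonpos) (auto simp: power2_norm_eq_inner)
      ultimately show "\<exists>y. (w has_real_derivative y) (at s) \<and> y \<le> 0"
        using dw[of s] s by auto
    qed
  qed simp
  then have "exp (2 * \<beta> * (t - t0)) * (norm (z t))\<^sup>2 \<le> (norm (z t0))\<^sup>2"
    by (simp add: w_def power2_norm_eq_inner)
  then have "(exp (\<beta> * (t - t0)) * norm (z t))\<^sup>2 \<le> (norm (z t0))\<^sup>2"
    by (simp add: power_mult_distrib exp_double[symmetric] mult.assoc)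
  then have "exp (\<beta> * (t - t0)) * norm (z t) \<le> norm (z t0)"
    by (rule power2_le_imp_le) simp
  then have "exp (- \<beta> * (t - t0)) * (exp (\<beta> * (t - t0)) * norm (z t))
      \<le> exp (- \<beta> * (t - t0)) * norm (z t0)"
    by (rule mult_left_mono) simp
  then show ?thesis
    by (simp add: mult.assoc[symmetric] exp_add[symmetric])
qed

lemma continuous_on_error_field:
  assumes "0 < g" "continuous_on S p" "continuous_on S q" "continuous_on S r" "continuous_on S c"
    and "continuous_on S \<phi>"
    and "\<And>f1 f2 f3. continuous_on S f1 \<Longrightarrow> continuous_on S f2 \<Longrightarrow> continuous_on S f3 \<Longrightarrow>
      continuous_on S (\<lambda>s. N s (f1 s) (f2 s) (f3 s))"
  shows "continuous_on S (\<lambda>s. error_field g k1 k2 k3 ku kv p q r c N s (\<phi> s))"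
  unfolding error_field_def split_def
  by (intro continuous_intros assms) (use assms(1) in auto)

lemma error_field_Lipschitz:
  assumes inj: "\<And>z1 z2 z3 w1 w2 w3 n.
      \<bar>z1 - w1\<bar> \<le> n \<Longrightarrow> \<bar>z2 - w2\<bar> \<le> n \<Longrightarrow> \<bar>z3 - w3\<bar> \<le> n \<Longrightarrow>
      \<bar>N t z1 z2 z3 - N t w1 w2 w3\<bar> \<le> C * n"
  shows "norm (error_field g k1 k2 k3 ku kv p q r c N t z - error_field g k1 k2 k3 ku kv p q r c N t w)
    \<le> (2 * \<bar>g\<bar> + \<bar>c t + ku\<bar> + \<bar>c t + kv\<bar> + 2 * \<bar>p t\<bar> + 2 * \<bar>q t\<bar> + 2 * \<bar>r t\<bar>
        + \<bar>k1\<bar> + \<bar>k2\<bar> + \<bar>k1 * c t / g\<bar> + \<bar>k2 * c t / g\<bar> + \<bar>k3\<bar> * C) * norm (z - w)"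
proof -
  obtain a b z1 z2 z3 where z: "z = (a, b, z1, z2, z3)" by (cases z)
  obtain a' b' w1 w2 w3 where w: "w = (a', b', w1, w2, w3)" by (cases w)
  let ?n = "norm (z - w)"
  have d: "\<bar>a - a'\<bar> \<le> ?n" "\<bar>b - b'\<bar> \<le> ?n" "\<bar>z1 - w1\<bar> \<le> ?n" "\<bar>z2 - w2\<bar> \<le> ?n" "\<bar>z3 - w3\<bar> \<le> ?n"
    unfolding z w diff_Pair by (rule abs_components_le_norm)+
  have scale: "\<bar>k * x\<bar> \<le> \<bar>k\<bar> * ?n" if "\<bar>x\<bar> \<le> ?n" for k x :: real
    using that by (simp add: abs_mult mult_left_mono)
  define NN where "NN = N t z1 z2 z3 - N t w1 w2 w3"
  have "\<bar>NN\<bar> \<le> C * ?n"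
    unfolding NN_def by (rule inj[OF d(3-5)])
  then have k3: "\<bar>k3 * NN\<bar> \<le> \<bar>k3\<bar> * (C * ?n)"
    by (simp add: abs_mult mult_left_mono)
  have "error_field g k1 k2 k3 ku kv p q r c N t z - error_field g k1 k2 k3 ku kv p q r c N t w =
    (g * (z1 - w1) - (c t + ku) * (a - a'),
     g * (z2 - w2) - (c t + kv) * (b - b'),
     r t * (z2 - w2) - q t * (z3 - w3) - k1 * (z1 - w1) + k1 * c t / g * (a - a'),
     p t * (z3 - w3) - r t * (z1 - w1) - k2 * (z2 - w2) + k2 * c t / g * (b - b'),
     q t * (z1 - w1) - p t * (z2 - w2) - k3 * NN)"
    by (simp add: error_field_def z w NN_def algebra_simps diff_divide_distrib)
  then have "norm (error_field g k1 k2 k3 ku kv p q r c N t z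
      - error_field g k1 k2 k3 ku kv p q r c N t w) \<le>
      \<bar>g * (z1 - w1) - (c t + ku) * (a - a')\<bar> + \<bar>g * (z2 - w2) - (c t + kv) * (b - b')\<bar>
      + \<bar>r t * (z2 - w2) - q t * (z3 - w3) - k1 * (z1 - w1) + k1 * c t / g * (a - a')\<bar>
      + \<bar>p t * (z3 - w3) - r t * (z1 - w1) - k2 * (z2 - w2) + k2 * c t / g * (b - b')\<bar>
      + \<bar>q t * (z1 - w1) - p t * (z2 - w2) - k3 * NN\<bar>"
    by (simp only: norm_le_sum_components)
  also have "\<dots> \<le> (\<bar>g\<bar> * ?n + \<bar>c t + ku\<bar> * ?n) + (\<bar>g\<bar> * ?n + \<bar>c t + kv\<bar> * ?n)
      + (\<bar>r t\<bar> * ?n + \<bar>q t\<bar> * ?n + \<bar>k1\<bar> * ?n + \<bar>k1 * c t / g\<bar> * ?n)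
      + (\<bar>p t\<bar> * ?n + \<bar>r t\<bar> * ?n + \<bar>k2\<bar> * ?n + \<bar>k2 * c t / g\<bar> * ?n)
      + (\<bar>q t\<bar> * ?n + \<bar>p t\<bar> * ?n + \<bar>k3\<bar> * (C * ?n))"
  proof -
    have tri2: "\<bar>x - y\<bar> \<le> x' + y'" if "\<bar>x\<bar> \<le> x'" "\<bar>y\<bar> \<le> y'" for x y x' y' :: real
      using that by linarith
    have tri4: "\<bar>x - y - s + e\<bar> \<le> x' + y' + s' + e'"
      if "\<bar>x\<bar> \<le> x'" "\<bar>y\<bar> \<le> y'" "\<bar>s\<bar> \<le> s'" "\<bar>e\<bar> \<le> e'" for x y s e x' y' s' e' :: real
      using that by linarith
    show ?thesis
      by (intro add_mono[of _ _ _ "_ + _ + _"] add_mono[of _ _ _ "_ + _"] add_mono tri4 tri2 scale d k3)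
  qed
  finally show ?thesis
    by (simp add: algebra_simps)
qed

section \<open>The observer along a trajectory\<close>

locale quadrotor_observer =
  fixes \<epsilon> g k1 k2 k3 ku kv c_u :: real
    and p q r c u v \<eta>1 \<eta>2 \<eta>3 ax ay :: "real \<Rightarrow> real"
  assumes eps: "0 < \<epsilon>" "\<epsilon> < 1"
    and g: "0 < g"
    and k3: "0 < k3"
    and k1: "1 + k3 / (2 * \<epsilon>\<^sup>2) < k1"
    and k2: "1 + k3 / (2 * \<epsilon>\<^sup>2) < k2"
    and ku: "k1\<^sup>2 * c_u\<^sup>2 / (2 * g\<^sup>2) + g\<^sup>2 / 2 < ku"
    and kv: "k2\<^sup>2 * c_u\<^sup>2 / (2 * g\<^sup>2) + g\<^sup>2 / 2 < kv"
    and cont: "continuous_on {0..} p" "continuous_on {0..} q" "continuous_on {0..} r"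
      "continuous_on {0..} c"
    and c: "0 \<le> t \<Longrightarrow> 0 < c t" "0 \<le> t \<Longrightarrow> c t \<le> c_u"
    and trajectory: "design_trajectory g p q r c u v \<eta>1 \<eta>2 \<eta>3"
    and upright: "0 \<le> t \<Longrightarrow> \<epsilon> \<le> \<eta>3 t"
    and accel: "0 \<le> t \<Longrightarrow> ax t = - c t * u t" "0 \<le> t \<Longrightarrow> ay t = - c t * v t"
begin

abbreviation plant :: "real \<Rightarrow> state" where
  "plant t \<equiv> (u t, v t, \<eta>1 t, \<eta>2 t, \<eta>3 t)"

abbreviation observer :: "real \<Rightarrow> state \<Rightarrow> state" where
  "observer \<equiv> observer_field \<epsilon> g k1 k2 k3 ku kv p q r c ax ay"

definition correction :: injection where
  "correction t z1 z2 z3 = E \<epsilon> (\<eta>1 t + z1) (\<eta>2 t + z2) (\<eta>3 t + z3)"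

definition clamped_correction :: "real \<Rightarrow> injection" where
  "clamped_correction M t z1 z2 z3 =
     E \<epsilon> (\<eta>1 t + z1) (\<eta>2 t + z2) (clamp_height M (\<eta>3 t + z3))"

abbreviation error_dynamics :: "injection \<Rightarrow> real \<Rightarrow> state \<Rightarrow> state" where
  "error_dynamics \<equiv> error_field g k1 k2 k3 ku kv p q r c"

abbreviation shear_in :: "state \<Rightarrow> state" where
  "shear_in \<equiv> shear (- (k1 / g)) (- (k2 / g))"

abbreviation shear_out :: "state \<Rightarrow> state" where
  "shear_out \<equiv> shear (k1 / g) (k2 / g)"

lemma sphere: "0 \<le> t \<Longrightarrow> (\<eta>1 t)\<^sup>2 + (\<eta>2 t)\<^sup>2 + (\<eta>3 t)\<^sup>2 = 1"
  using trajectory by (simp add: design_trajectory_def)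

lemma plant_derivative:
  assumes "0 \<le> t0" "t0 \<le> t"
  shows "(plant has_vector_derivative design_field g p q r c t (plant t)) (at t within {t0..})"
  using trajectory assms
  by (auto simp: design_trajectory_def solves_ode_from_def
      intro: has_vector_derivative_within_subset[where S="{0..}"])

lemma shear_out_in: "shear_out (shear_in z) = z"
  by (rule shear_inverse)

lemma shear_in_out: "shear_in (shear_out z) = z"
  using shear_inverse[of "- (k1 / g)" "- (k2 / g)" z] by simp

text \<open>
  The next three lemmas state that \<open>y = plant + shear_out z\<close> translates solutions of the error system
  and of the observer into each other: existence is transported forward, decay backward.
\<close>

lemma observer_conjugate:
  assumes "0 \<le> t"
  shows "observer t (plant t + shear_out z)
    = design_field g p q r c t (plant t) + shear_out (error_dynamics correction t z)"
  using observer_field_eq_error_field[where c=c and t=t and ax=ax and ay=ay and u="u t" and v="v t",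
      OF g c(1)[OF assms] accel[OF assms], of \<epsilon> k1 k2 k3 ku kv p q r "\<eta>1 t" "\<eta>2 t" "\<eta>3 t" z]
  by (simp add: error_field_def correction_def)

lemma observer_of_error:
  assumes "0 \<le> t0" and "solves_ode_from (error_dynamics correction) t0 z"
  shows "solves_ode_from observer t0 (\<lambda>t. plant t + shear_out (z t))"
  unfolding solves_ode_from_def
proof (intro allI impI)
  fix t assume t: "t0 \<le> t"
  have "(z has_vector_derivative error_dynamics correction t (z t)) (at t within {t0..})"
    using assms(2) t by (simp add: solves_ode_from_def)
  from bounded_linear.has_vector_derivative[OF bounded_linear_shear this, of "k1 / g" "k2 / g"]
  show "((\<lambda>t. plant t + shear_out (z t)) has_vector_derivative
      observer t (plant t + shear_out (z t))) (at t within {t0..})"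
    unfolding observer_conjugate[OF order_trans[OF assms(1) t]]
    by (intro has_vector_derivative_add plant_derivative assms(1) t)
qed

lemma error_of_observer:
  assumes "0 \<le> t0" and "solves_ode_from observer t0 y"
  shows "solves_ode_from (error_dynamics correction) t0 (\<lambda>t. shear_in (y t - plant t))"
  unfolding solves_ode_from_def
proof (intro allI impI)
  fix t assume t: "t0 \<le> t"
  let ?z = "shear_in (y t - plant t)"
  have "(y has_vector_derivative observer t (y t)) (at t within {t0..})"
    using assms(2) t by (simp add: solves_ode_from_def)
  also have "y t = plant t + shear_out ?z"
    by (simp only: shear_out_in) simp
  finally have "((\<lambda>t. y t - plant t) has_vector_derivative
      shear_out (error_dynamics correction t ?z)) (at t within {t0..})"
    unfolding observer_conjugate[OF order_trans[OF assms(1) t]]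
    by (rule has_vector_derivative_eq_rhs[OF has_vector_derivative_diff[OF _ plant_derivative[OF assms(1) t]]])
      simp
  from bounded_linear.has_vector_derivative[OF bounded_linear_shear this,
      of "- (k1 / g)" "- (k2 / g)"]
  show "((\<lambda>t. shear_in (y t - plant t)) has_vector_derivative
      error_dynamics correction t ?z) (at t within {t0..})"
    by (simp only: shear_in_out)
qed

section \<open>Decay of the error\<close>

text \<open>
  The smallest of the five damping coefficients in \<open>error_field_dissipation\<close>. For \<open>\<sigma> = 0\<close> it
  vanishes, so that the same estimate also yields mere monotonicity.
\<close>

definition decay_rate :: "real \<Rightarrow> real" where
  "decay_rate \<sigma> = Min {ku - (k1\<^sup>2 * c_u\<^sup>2 / (2 * g\<^sup>2) + g\<^sup>2 / 2),
     kv - (k2\<^sup>2 * c_u\<^sup>2 / (2 * g\<^sup>2) + g\<^sup>2 / 2),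
     k1 - (1 + k3 / (2 * \<epsilon>\<^sup>2)), k2 - (1 + k3 / (2 * \<epsilon>\<^sup>2)), k3 * \<sigma>}"

lemma decay_rate_pos: "0 < \<sigma> \<Longrightarrow> 0 < decay_rate \<sigma>"
  using k1 k2 k3 ku kv by (simp add: decay_rate_def)

lemma decay_rate_0: "decay_rate 0 = 0"
  using k1 k2 ku kv by (simp add: decay_rate_def)

lemma error_dynamics_dissipation:
  assumes "0 \<le> t" "z = (a, b, z1, z2, z3)"
    and "- z3 * N t z1 z2 z3 \<le> (z1\<^sup>2 + z2\<^sup>2) / (2 * \<epsilon>\<^sup>2) - \<sigma> * z3\<^sup>2"
  shows "inner z (error_dynamics N t z) \<le> - decay_rate \<sigma> * (norm z)\<^sup>2"
proof -
  let ?\<beta> = "decay_rate \<sigma>"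
  have "?\<beta> \<le> ku - (k1\<^sup>2 * c_u\<^sup>2 / (2 * g\<^sup>2) + g\<^sup>2 / 2)"
    "?\<beta> \<le> kv - (k2\<^sup>2 * c_u\<^sup>2 / (2 * g\<^sup>2) + g\<^sup>2 / 2)"
    "?\<beta> \<le> k1 - (1 + k3 / (2 * \<epsilon>\<^sup>2))" "?\<beta> \<le> k2 - (1 + k3 / (2 * \<epsilon>\<^sup>2))" "?\<beta> \<le> k3 * \<sigma>"
    unfolding decay_rate_def by (auto intro!: Min_le simp del: Min_insert)
  then have "?\<beta> * a\<^sup>2 + ?\<beta> * b\<^sup>2 + ?\<beta> * z1\<^sup>2 + ?\<beta> * z2\<^sup>2 + ?\<beta> * z3\<^sup>2
    \<le> (ku - (k1\<^sup>2 * c_u\<^sup>2 / (2 * g\<^sup>2) + g\<^sup>2 / 2)) * a\<^sup>2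
      + (kv - (k2\<^sup>2 * c_u\<^sup>2 / (2 * g\<^sup>2) + g\<^sup>2 / 2)) * b\<^sup>2
      + (k1 - (1 + k3 / (2 * \<epsilon>\<^sup>2))) * z1\<^sup>2 + (k2 - (1 + k3 / (2 * \<epsilon>\<^sup>2))) * z2\<^sup>2
      + k3 * \<sigma> * z3\<^sup>2"
    by (intro add_mono mult_right_mono) auto
  moreover have "?\<beta> * (norm z)\<^sup>2
    = ?\<beta> * a\<^sup>2 + ?\<beta> * b\<^sup>2 + ?\<beta> * z1\<^sup>2 + ?\<beta> * z2\<^sup>2 + ?\<beta> * z3\<^sup>2"
    unfolding assms(2) norm_state_square by (simp only: distrib_left)
  ultimately show ?thesis
    using error_field_dissipation[where c=c and t=t and N=N, OF assms(2) g k3 c[OF assms(1)] assms(3),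
        of k1 k2 ku kv p q r] by linarith
qed

lemma clamped_error_nonincreasing:
  assumes "0 \<le> t0" "t0 \<le> t" "1 \<le> M"
    and "solves_ode_from (error_dynamics (clamped_correction M)) t0 z"
  shows "norm (z t) \<le> norm (z t0)"
proof -
  have "norm (z t) \<le> exp (- 0 * (t - t0)) * norm (z t0)"
  proof (rule norm_decay_of_dissipative[OF assms(4,2)])
    fix s assume "t0 \<le> s"
    then have s: "0 \<le> s" using assms(1) by simp
    obtain a b z1 z2 z3 where z: "z s = (a, b, z1, z2, z3)" by (cases "z s")
    have "- z3 * clamped_correction M s z1 z2 z3 \<le> (z1\<^sup>2 + z2\<^sup>2) / (2 * \<epsilon>\<^sup>2) - 0 * z3\<^sup>2"
      unfolding clamped_correction_def
      using E_clamped_dissipation[OF eps sphere[OF s] upright[OF s] assms(3)] by simp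
    from error_dynamics_dissipation[where N="clamped_correction M", OF s z this]
    show "inner (z s) (error_dynamics (clamped_correction M) s (z s)) \<le> - 0 * (norm (z s))\<^sup>2"
      by (simp add: decay_rate_0)
  qed
  then show ?thesis by simp
qed

text \<open>
  On the ball of radius \<open>\<rho>\<close> the denominator of \<open>E\<close> is at most \<open>3 + 2 \<rho>\<^sup>2\<close>, because the true
  direction has norm 1. This turns the damping of \<open>z3\<close> into a uniform one.
\<close>

lemma correction_dissipation:
  fixes a b z1 z2 z3 :: real
  assumes "0 \<le> t" "norm (a, b, z1, z2, z3) \<le> \<rho>"
  shows "- z3 * correction t z1 z2 z3
    \<le> (z1\<^sup>2 + z2\<^sup>2) / (2 * \<epsilon>\<^sup>2) - 1 / (2 * (3 + 2 * \<rho>\<^sup>2)) * z3\<^sup>2"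
proof -
  let ?D = "(\<eta>1 t + z1)\<^sup>2 + (\<eta>2 t + z2)\<^sup>2 + 1 - \<epsilon>\<^sup>2"
  have D0: "0 < ?D" by (rule denominator_pos[OF eps])
  have "(norm (a, b, z1, z2, z3))\<^sup>2 \<le> \<rho>\<^sup>2"
    using assms(2) by (intro power_mono) auto
  then have "a\<^sup>2 + b\<^sup>2 + z1\<^sup>2 + z2\<^sup>2 + z3\<^sup>2 \<le> \<rho>\<^sup>2"
    by (simp only: norm_state_square)
  moreover have "(x + y)\<^sup>2 \<le> 2 * x\<^sup>2 + 2 * y\<^sup>2" for x y :: real
    using sum_squares_bound[of x y] by (simp add: power2_sum)
  from this[of "\<eta>1 t" z1] this[of "\<eta>2 t" z2]
  have "(\<eta>1 t + z1)\<^sup>2 + (\<eta>2 t + z2)\<^sup>2 \<le> 2 * (\<eta>1 t)\<^sup>2 + 2 * z1\<^sup>2 + 2 * (\<eta>2 t)\<^sup>2 + 2 * z2\<^sup>2"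
    by linarith
  ultimately have "?D \<le> 3 + 2 * \<rho>\<^sup>2"
    using sphere[OF assms(1)] zero_le_power2[of \<epsilon>] zero_le_power2[of "\<eta>3 t"]
      zero_le_power2[of a] zero_le_power2[of b] zero_le_power2[of z3] by linarith
  then have "z3\<^sup>2 / (2 * (3 + 2 * \<rho>\<^sup>2)) \<le> z3\<^sup>2 / (2 * ?D)"
    using D0 by (intro divide_left_mono) auto
  then show ?thesis
    using E_dissipation[OF eps sphere[OF assms(1)] upright[OF assms(1)], of z3 z1 z2]
    by (simp add: correction_def)
qed

lemma error_nonincreasing:
  assumes "0 \<le> t0" "t0 \<le> t" and "solves_ode_from (error_dynamics correction) t0 z"
  shows "norm (z t) \<le> norm (z t0)"
proof -
  have "norm (z t) \<le> exp (- 0 * (t - t0)) * norm (z t0)"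
  proof (rule norm_decay_of_dissipative[OF assms(3,2)])
    fix s assume "t0 \<le> s"
    then have s: "0 \<le> s" using assms(1) by simp
    obtain a b z1 z2 z3 where z: "z s = (a, b, z1, z2, z3)" by (cases "z s")
    have "- z3 * correction s z1 z2 z3 \<le> (z1\<^sup>2 + z2\<^sup>2) / (2 * \<epsilon>\<^sup>2) - 0 * z3\<^sup>2"
      using correction_dissipation[OF s order_refl, of z3 z1 z2 a b]
      by (rule order_trans) simp
    from error_dynamics_dissipation[where N=correction, OF s z this]
    show "inner (z s) (error_dynamics correction s (z s)) \<le> - 0 * (norm (z s))\<^sup>2"
      by (simp add: decay_rate_0)
  qed
  then show ?thesis by simp
qed

definition rate_on_ball :: "real \<Rightarrow> real" where
  "rate_on_ball \<rho> = decay_rate (1 / (2 * (3 + 2 * \<rho>\<^sup>2)))"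

lemma rate_on_ball_pos: "0 < rate_on_ball \<rho>"
  unfolding rate_on_ball_def
  by (rule decay_rate_pos) (simp add: add_pos_nonneg)

text \<open>
  By \<open>error_nonincreasing\<close> the solution never leaves the ball of radius \<open>\<rho>\<close> that contains its
  initial value, so the rate of that ball applies at all times.
\<close>

lemma error_exponential_decay:
  assumes "0 \<le> t0" "t0 \<le> t" and sol: "solves_ode_from (error_dynamics correction) t0 z"
    and "norm (z t0) \<le> \<rho>"
  shows "norm (z t) \<le> exp (- rate_on_ball \<rho> * (t - t0)) * norm (z t0)"
proof (rule norm_decay_of_dissipative[OF sol assms(2)])
  fix s assume t0s: "t0 \<le> s"
  then have s: "0 \<le> s" using assms(1) by simp
  obtain a b z1 z2 z3 where z: "z s = (a, b, z1, z2, z3)" by (cases "z s")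
  have "norm (a, b, z1, z2, z3) \<le> \<rho>"
    using error_nonincreasing[OF assms(1) t0s sol] assms(4) z by simp
  from error_dynamics_dissipation[where N=correction, OF s z correction_dissipation[OF s this]]
  show "inner (z s) (error_dynamics correction s (z s)) \<le> - rate_on_ball \<rho> * (norm (z s))\<^sup>2"
    by (simp add: rate_on_ball_def)
qed

section \<open>Existence of solutions\<close>

lemma plant_components_continuous:
  "continuous_on {0..} \<eta>1" "continuous_on {0..} \<eta>2" "continuous_on {0..} \<eta>3"
proof -
  have "continuous_on {0..} plant"
    by (rule continuous_on_vector_derivative[OF plant_derivative[of 0]]) auto
  then have "continuous_on {0..} (\<lambda>t. fst (snd (snd (plant t))))"
    "continuous_on {0..} (\<lambda>t. fst (snd (snd (snd (plant t)))))"
    "continuous_on {0..} (\<lambda>t. snd (snd (snd (snd (plant t)))))"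
    by (intro continuous_on_fst continuous_on_snd; assumption)+
  then show "continuous_on {0..} \<eta>1" "continuous_on {0..} \<eta>2" "continuous_on {0..} \<eta>3"
    by simp_all
qed

lemma clamped_error_solution:
  assumes "0 \<le> t0" "1 \<le> M"
  shows "\<exists>z. solves_ode_from (error_dynamics (clamped_correction M)) t0 z \<and> z t0 = z0"
proof -
  obtain C where C: "\<And>x1 x2 x3 y1 y2 y3 n.
      \<bar>x1 - y1\<bar> \<le> n \<Longrightarrow> \<bar>x2 - y2\<bar> \<le> n \<Longrightarrow> \<bar>x3 - y3\<bar> \<le> n \<Longrightarrow>
      \<bar>E \<epsilon> x1 x2 (clamp_height M x3) - E \<epsilon> y1 y2 (clamp_height M y3)\<bar> \<le> C * n"
    using E_clamped_Lipschitz[OF eps assms(2)] by metis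
  have sub: "{t0..} \<subseteq> {0..}" using assms(1) by auto
  note cont' = cont[THEN continuous_on_subset, OF sub]
    plant_components_continuous[THEN continuous_on_subset, OF sub]
  show ?thesis
  proof (rule global_solution_of_Lipschitz_field)
    show "continuous_on {t0..} (\<lambda>s. error_dynamics (clamped_correction M) s (\<phi> s))"
      if "continuous_on {t0..} \<phi>" for \<phi>
      unfolding clamped_correction_def
      by (intro continuous_on_error_field g cont' that continuous_on_E_clamped eps continuous_on_add)
    show "norm (error_dynamics (clamped_correction M) t z - error_dynamics (clamped_correction M) t w)
      \<le> (2 * \<bar>g\<bar> + \<bar>c t + ku\<bar> + \<bar>c t + kv\<bar> + 2 * \<bar>p t\<bar> + 2 * \<bar>q t\<bar> + 2 * \<bar>r t\<bar>
        + \<bar>k1\<bar> + \<bar>k2\<bar> + \<bar>k1 * c t / g\<bar> + \<bar>k2 * c t / g\<bar> + \<bar>k3\<bar> * C) * norm (z - w)" for t z w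
      by (rule error_field_Lipschitz) (auto simp: clamped_correction_def intro!: C)
    show "continuous_on {t0..} (\<lambda>t. 2 * \<bar>g\<bar> + \<bar>c t + ku\<bar> + \<bar>c t + kv\<bar>
        + 2 * \<bar>p t\<bar> + 2 * \<bar>q t\<bar> + 2 * \<bar>r t\<bar>
        + \<bar>k1\<bar> + \<bar>k2\<bar> + \<bar>k1 * c t / g\<bar> + \<bar>k2 * c t / g\<bar> + \<bar>k3\<bar> * C)"
      by (intro continuous_intros cont') (use g in auto)
  qed
qed

text \<open>
  A solution of the clamped system keeps \<open>\<bar>z3\<bar>\<close> below the initial error norm, so the
  estimated height stays within \<open>1 + norm z0\<close>. With this bound as the clamp, the solution
  satisfies the original equation.
\<close>

lemma error_solution:
  assumes "0 \<le> t0"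
  shows "\<exists>z. solves_ode_from (error_dynamics correction) t0 z \<and> z t0 = z0"
proof -
  define M where "M = 1 + norm z0"
  have M: "1 \<le> M" by (simp add: M_def)
  obtain z where sol: "solves_ode_from (error_dynamics (clamped_correction M)) t0 z"
    and init: "z t0 = z0"
    using clamped_error_solution[OF assms M] by blast
  have "error_dynamics (clamped_correction M) t (z t) = error_dynamics correction t (z t)"
    if "t0 \<le> t" for t
  proof -
    obtain a b z1 z2 z3 where z: "z t = (a, b, z1, z2, z3)" by (cases "z t")
    have "(\<eta>3 t)\<^sup>2 \<le> 1"
      using sphere[of t] assms that zero_le_power2[of "\<eta>1 t"] zero_le_power2[of "\<eta>2 t"] by linarith
    then have "\<bar>\<eta>3 t\<bar> \<le> 1" by (simp add: abs_square_le_1)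
    moreover have "\<bar>z3\<bar> \<le> norm z0"
      using abs_components_le_norm(5)[of z3 a b z1 z2]
        clamped_error_nonincreasing[OF assms that M sol] by (simp add: z init)
    ultimately have "clamp_height M (\<eta>3 t + z3) = \<eta>3 t + z3"
      unfolding M_def by (intro clamp_height_id) linarith
    then show ?thesis
      by (simp add: z error_field_def clamped_correction_def correction_def)
  qed
  then show ?thesis
    using sol init by (auto simp: solves_ode_from_def)
qed

lemma observer_solution:
  assumes "0 \<le> t0"
  shows "\<exists>y. solves_ode_from observer t0 y \<and> y t0 = \<xi>"
proof -
  obtain z where "solves_ode_from (error_dynamics correction) t0 z"
    "z t0 = shear_in (\<xi> - plant t0)"
    using error_solution[OF assms] by blast
  then show ?thesis
    using observer_of_error[OF assms, of z]
    by (intro exI[of _ "\<lambda>t. plant t + shear_out (z t)"]) (simp only: shear_out_in, simp)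
qed

section \<open>Uniform convergence\<close>

lemma observer_error_uniform:
  assumes "0 < R" "0 < \<delta>"
  shows "\<exists>T>0. \<forall>t0\<ge>0. \<forall>y. solves_ode_from observer t0 y \<and> norm (y t0 - plant t0) \<le> R \<longrightarrow>
    (\<forall>t\<ge>t0 + T. norm (y t - plant t) \<le> \<delta>)"
proof -
  define K where "K = 1 + \<bar>k1 / g\<bar> + \<bar>k2 / g\<bar>"
  have K: "0 < K" by (simp add: K_def add_pos_nonneg)
  have shear_le: "norm (shear_out z) \<le> K * norm z" "norm (shear_in z) \<le> K * norm z" for z
    using norm_shear[of "k1 / g" "k2 / g" z] norm_shear[of "- (k1 / g)" "- (k2 / g)" z]
    by (simp_all add: K_def)
  define \<beta> where "\<beta> = rate_on_ball (K * R)"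
  have \<beta>: "0 < \<beta>" unfolding \<beta>_def by (rule rate_on_ball_pos)
  \<comment> \<open>By \<open>exp x \<ge> x\<close> this time makes the exponential factor at most \<open>\<delta> / (K (K R))\<close>.\<close>
  define T where "T = K * (K * R) / (\<delta> * \<beta>)"
  have T: "0 < T" using K \<beta> assms by (simp add: T_def)
  show ?thesis
  proof (intro exI[of _ T] conjI allI impI T; elim conjE)
    fix t0 y t assume t0: "0 \<le> t0" and sol: "solves_ode_from observer t0 y"
      and R: "norm (y t0 - plant t0) \<le> R" and t: "t0 + T \<le> t"
    define z where "z t = shear_in (y t - plant t)" for t
    have zsol: "solves_ode_from (error_dynamics correction) t0 z"
      unfolding z_def by (rule error_of_observer[OF t0 sol])
    have z0: "norm (z t0) \<le> K * R"
      unfolding z_def using R K by (intro order_trans[OF shear_le(2)] mult_left_mono) auto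
    have "K * (K * R) / \<delta> = \<beta> * T"
      using \<beta> by (simp add: T_def field_simps)
    also have "\<dots> \<le> \<beta> * (t - t0)"
      using \<beta> t by (intro mult_left_mono) auto
    also have "\<dots> \<le> exp (\<beta> * (t - t0))"
      using exp_ge_add_one_self[of "\<beta> * (t - t0)"] by linarith
    finally have "K * (K * R) \<le> exp (\<beta> * (t - t0)) * \<delta>"
      using assms by (simp add: field_simps)
    then have "exp (- \<beta> * (t - t0)) * (K * (K * R))
        \<le> exp (- \<beta> * (t - t0)) * (exp (\<beta> * (t - t0)) * \<delta>)"
      by (rule mult_left_mono) simp
    then have small: "exp (- \<beta> * (t - t0)) * (K * (K * R)) \<le> \<delta>"
      by (simp add: mult.assoc[symmetric] exp_add[symmetric])
    have "norm (y t - plant t) = norm (shear_out (z t))"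
      unfolding z_def by (simp only: shear_out_in)
    also have "\<dots> \<le> K * norm (z t)" by (rule shear_le(1))
    also have "\<dots> \<le> K * (exp (- \<beta> * (t - t0)) * norm (z t0))"
      unfolding \<beta>_def using K t T
      by (intro mult_left_mono error_exponential_decay[OF t0 _ zsol z0]) auto
    also have "\<dots> \<le> K * (exp (- \<beta> * (t - t0)) * (K * R))"
      using K z0 by (intro mult_left_mono) auto
    also have "\<dots> \<le> \<delta>" using small by (simp add: mult_ac)
    finally show "norm (y t - plant t) \<le> \<delta>" .
  qed
qed

lemma observer_error_tendsto_0:
  assumes "solves_ode_from observer 0 y"
  shows "((\<lambda>t. y t - plant t) \<longlongrightarrow> 0) at_top"
proof (rule tendstoI)
  fix e :: real assume "0 < e"
  then obtain T where "\<forall>t\<ge>0 + T. norm (y t - plant t) \<le> e / 2"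
    using observer_error_uniform[of "norm (y 0 - plant 0) + 1" "e / 2"] assms
    by (smt (verit) half_gt_zero norm_ge_zero order_refl)
  then show "eventually (\<lambda>t. dist (y t - plant t) 0 < e) at_top"
    using \<open>0 < e\<close> by (intro eventually_at_top_linorderI[of T]) (force simp: dist_norm)
qed

end

theorem proposition1:
  fixes g c_l c_u :: real
  assumes "0 < g" and "0 \<le> c_l" and "c_l \<le> c_u"
  shows "\<exists>\<epsilon>0::real. 0 < \<epsilon>0 \<and> \<epsilon>0 < 1 \<and>
    (\<forall>\<epsilon> k1 k2 k3 ku kv :: real.
      0 < \<epsilon> \<and> \<epsilon> \<le> \<epsilon>0 \<and>
      k3 > 0 \<and> k1 > 1 + k3 / (2 * \<epsilon>\<^sup>2) \<and> k2 > 1 + k3 / (2 * \<epsilon>\<^sup>2) \<and>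
      ku > k1\<^sup>2 * c_u\<^sup>2 / (2 * g\<^sup>2) + g\<^sup>2 / 2 \<and>
      kv > k2\<^sup>2 * c_u\<^sup>2 / (2 * g\<^sup>2) + g\<^sup>2 / 2 \<longrightarrow>
      (\<forall>p q r c u v \<eta>1 \<eta>2 \<eta>3 ax ay :: real \<Rightarrow> real.
        continuous_on {0..} p \<and> continuous_on {0..} q \<and>
        continuous_on {0..} r \<and> continuous_on {0..} c \<and>
        (\<forall>t\<ge>0. 0 < c t \<and> c_l \<le> c t \<and> c t \<le> c_u) \<and>
        design_trajectory g p q r c u v \<eta>1 \<eta>2 \<eta>3 \<and>
        (\<forall>t\<ge>0. \<epsilon> \<le> \<eta>3 t) \<and>
        (\<forall>t\<ge>0. ax t = - c t * u t \<and> ay t = - c t * v t) \<longrightarrow>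
        (let F = observer_field \<epsilon> g k1 k2 k3 ku kv p q r c ax ay;
             x = (\<lambda>t. (u t, v t, \<eta>1 t, \<eta>2 t, \<eta>3 t))
         in
          (\<forall>t0\<ge>0. \<forall>\<xi>. \<exists>y. solves_ode_from F t0 y \<and> y t0 = \<xi>) \<and>
          (\<forall>y. solves_ode_from F 0 y \<longrightarrow> ((\<lambda>t. y t - x t) \<longlongrightarrow> 0) at_top) \<and>
          (\<forall>R>0. \<forall>\<delta>>0. \<exists>T>0. \<forall>t0\<ge>0. \<forall>y.
             solves_ode_from F t0 y \<and> norm (y t0 - x t0) \<le> R \<longrightarrow>
             (\<forall>t\<ge>t0 + T. norm (y t - x t) \<le> \<delta>)))))"
  \<comment> \<open>The lemmas hold for every \<open>\<epsilon>\<close> below 1, so any witness in \<open>(0, 1)\<close> serves.\<close>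
proof (intro exI[of _ "1/2 :: real"] conjI allI impI; (elim conjE)?)
  fix \<epsilon> k1 k2 k3 ku kv :: real and p q r c u v \<eta>1 \<eta>2 \<eta>3 ax ay :: "real \<Rightarrow> real"
  assume "0 < \<epsilon>" "\<epsilon> \<le> 1/2" "0 < k3" "1 + k3 / (2 * \<epsilon>\<^sup>2) < k1" "1 + k3 / (2 * \<epsilon>\<^sup>2) < k2"
    "k1\<^sup>2 * c_u\<^sup>2 / (2 * g\<^sup>2) + g\<^sup>2 / 2 < ku" "k2\<^sup>2 * c_u\<^sup>2 / (2 * g\<^sup>2) + g\<^sup>2 / 2 < kv"
    "continuous_on {0..} p" "continuous_on {0..} q" "continuous_on {0..} r" "continuous_on {0..} c"
    "\<forall>t\<ge>0. 0 < c t \<and> c_l \<le> c t \<and> c t \<le> c_u"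
    "design_trajectory g p q r c u v \<eta>1 \<eta>2 \<eta>3" "\<forall>t\<ge>0. \<epsilon> \<le> \<eta>3 t"
    "\<forall>t\<ge>0. ax t = - c t * u t \<and> ay t = - c t * v t"
  then interpret quadrotor_observer \<epsilon> g k1 k2 k3 ku kv c_u p q r c u v \<eta>1 \<eta>2 \<eta>3 ax ay
    using assms(1) by unfold_locales auto
  show "let F = observer_field \<epsilon> g k1 k2 k3 ku kv p q r c ax ay;
            x = (\<lambda>t. (u t, v t, \<eta>1 t, \<eta>2 t, \<eta>3 t))
        in
          (\<forall>t0\<ge>0. \<forall>\<xi>. \<exists>y. solves_ode_from F t0 y \<and> y t0 = \<xi>) \<and>
          (\<forall>y. solves_ode_from F 0 y \<longrightarrow> ((\<lambda>t. y t - x t) \<longlongrightarrow> 0) at_top) \<and>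
          (\<forall>R>0. \<forall>\<delta>>0. \<exists>T>0. \<forall>t0\<ge>0. \<forall>y.
             solves_ode_from F t0 y \<and> norm (y t0 - x t0) \<le> R \<longrightarrow>
             (\<forall>t\<ge>t0 + T. norm (y t - x t) \<le> \<delta>))"
    unfolding Let_def
    using observer_solution observer_error_tendsto_0 observer_error_uniform by blast
qed auto

end
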